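(* Let $1<\alpha<2$ and $\gamma>0$, let $\{X_n,n\ge1\}$ be a sequence of negatively associated, identically distributed real random variables, and let $X$ be a random variable with the same distribution as the $X_n$. Then the following statements are equivalent. (i) $E(X)=0$ and $E\left(|X|^\alpha/\log^{\alpha/\gamma}(|X|+2)\right)<\infty$. (ii) For every array of real constants $\{a_{ni},n\ge1,1\le i\le n\}$ for which there is a constant $C$ (not depending on $n$) such that $\sum_{i=1}^n a_{ni}^2\le Cn$ for all $n\ge1$, we have $$\sum_{n=1}^\infty n^{-1}P\left(\max_{1\le k\le n}\left|\sum_{i=1}^k a_{ni}X_i\right|>\varepsilon n^{1/\alpha}\log^{1/\gamma}(n)\right)<\infty\quad\text{for all }\varepsilon>0.$$ (iii) $$\lim_{n\to\infty}\frac{\max_{1\le k\le n}\left|\sum_{i=1}^kX_i\right|}{n^{1/\alpha}\log^{1/\gamma}n}=0\quad\text{almost surely.}$$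
   Context: $\log$ denotes the logarithm to base $2$, and $\log^{p}(x)$ means $(\log x)^p$. Negative association: a finite collection $\{X_1,\dots,X_n\}$ of random variables is negatively associated if for any disjoint subsets $I,J$ of $\{1,\dots,n\}$ and any real coordinatewise nondecreasing functions $f$ on $\mathbb{R}^{|I|}$ and $g$ on $\mathbb{R}^{|J|}$, $\mathrm{Cov}(f(X_k,k\in I),g(X_k,k\in J))\le0$ whenever the covariance exists. A sequence is negatively associated if every finite subfamily is. *)

theory Defs
  imports "HOL-Probability.Probability"
begin

context prob_space
begin

definition cov_exists :: "('a \<Rightarrow> real) \<Rightarrow> ('a \<Rightarrow> real) \<Rightarrow> bool" where
  "cov_exists F G \<longleftrightarrow> integrable M F \<and> integrable M G \<and> integrable M (\<lambda>\<omega>. F \<omega> * G \<omega>)"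

definition covariance :: "('a \<Rightarrow> real) \<Rightarrow> ('a \<Rightarrow> real) \<Rightarrow> real" where
  "covariance F G = expectation (\<lambda>\<omega>. (F \<omega> - expectation F) * (G \<omega> - expectation G))"

text \<open>
  The space of real vectors indexed by \<open>I\<close> is \<open>I \<rightarrow>\<^sub>E UNIV\<close>. Its elements all equal \<open>undefined\<close>
  off \<open>I\<close>, so on it the pointwise order of functions is the coordinatewise order and
  \<open>mono_on\<close> is coordinatewise monotonicity. The functions \<open>f\<close> and \<open>g\<close> are not required to be
  Borel measurable: \<open>cov_exists\<close> includes measurability of the composites.
\<close>

definition neg_assoc_finite :: "'i set \<Rightarrow> ('i \<Rightarrow> 'a \<Rightarrow> real) \<Rightarrow> bool" where
  "neg_assoc_finite K X \<longleftrightarrow>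
    (\<forall>I J. \<forall>f g :: ('i \<Rightarrow> real) \<Rightarrow> real.
      I \<subseteq> K \<longrightarrow> J \<subseteq> K \<longrightarrow> I \<inter> J = {} \<longrightarrow>
      mono_on (I \<rightarrow>\<^sub>E UNIV) f \<longrightarrow> mono_on (J \<rightarrow>\<^sub>E UNIV) g \<longrightarrow>
      cov_exists (\<lambda>\<omega>. f (\<lambda>k\<in>I. X k \<omega>)) (\<lambda>\<omega>. g (\<lambda>k\<in>J. X k \<omega>)) \<longrightarrow>
      covariance (\<lambda>\<omega>. f (\<lambda>k\<in>I. X k \<omega>)) (\<lambda>\<omega>. g (\<lambda>k\<in>J. X k \<omega>)) \<le> 0)"

definition neg_assoc :: "'i set \<Rightarrow> ('i \<Rightarrow> 'a \<Rightarrow> real) \<Rightarrow> bool" where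
  "neg_assoc T X \<longleftrightarrow> (\<forall>K. finite K \<longrightarrow> K \<subseteq> T \<longrightarrow> neg_assoc_finite K X)"

end

end

theory Submission
  imports Defs
begin

text \<open>
  Write \<open>b n = n powr (1/\<alpha>) * log 2 n powr (1/\<gamma>)\<close>; up to constants the moment in (i) counts the
  indices \<open>n\<close> with \<open>b n < \<bar>X0\<bar>\<close>.
  For (i) to (ii), clip every \<open>X i\<close> at the level \<open>b n\<close>, whatever the weights are. Then only second
  moments of the weights enter: by Kolmogorov's maximal inequality the \<open>n\<close>-th term of the series is
  eventually at most a constant times \<open>E (min 1 (X0\<^sup>2 / (b n)\<^sup>2))\<close>, and since \<open>\<alpha> < 2\<close> the sum of
  \<open>min 1 (x\<^sup>2 / (b n)\<^sup>2)\<close> over \<open>n\<close> is comparable to the number of \<open>n\<close> with \<open>b n < \<bar>x\<bar>\<close>.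
  The maximal inequality holds under negative association because \<open>T k = max 0 (Z k + T (k + 1))\<close>
  satisfies \<open>E (T k)\<^sup>2 \<le> E (Z k)\<^sup>2 + E (T (k + 1))\<^sup>2\<close>, the cross term being a nonpositive covariance.
  (ii) gives (iii) by the first Borel--Cantelli lemma along powers of 2. Under (iii) the events
  \<open>X n > b n\<close> and \<open>- X n > b n\<close> occur finitely often, and negative association supplies the second
  Borel--Cantelli lemma, hence the moment in (i); the strong law for \<open>X i - E X0\<close> together with
  \<open>n / b n \<rightarrow> \<infinity>\<close> then forces \<open>E X0 = 0\<close>.
\<close>

section \<open>Negative association\<close>

context prob_space
begin

lemma neg_assocD:
  assumes "neg_assoc T X" "finite I" "finite J" "I \<subseteq> T" "J \<subseteq> T" "I \<inter> J = {}"
    and "mono_on (I \<rightarrow>\<^sub>E UNIV) f" "mono_on (J \<rightarrow>\<^sub>E UNIV) g"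
    and "cov_exists (\<lambda>\<omega>. f (\<lambda>k\<in>I. X k \<omega>)) (\<lambda>\<omega>. g (\<lambda>k\<in>J. X k \<omega>))"
  shows "covariance (\<lambda>\<omega>. f (\<lambda>k\<in>I. X k \<omega>)) (\<lambda>\<omega>. g (\<lambda>k\<in>J. X k \<omega>)) \<le> 0"
proof -
  have "neg_assoc_finite (I \<union> J) X"
    using assms unfolding neg_assoc_def by simp
  then show ?thesis
    using assms unfolding neg_assoc_finite_def by blast
qed

lemma covariance_eq:
  assumes "cov_exists F G"
  shows "covariance F G = expectation (\<lambda>\<omega>. F \<omega> * G \<omega>) - expectation F * expectation G"
proof -
  have [simp]: "integrable M F" "integrable M G" "integrable M (\<lambda>\<omega>. F \<omega> * G \<omega>)"
    using assms by (auto simp: cov_exists_def)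
  have "covariance F G = expectation (\<lambda>\<omega>. F \<omega> * G \<omega> - expectation G * F \<omega>
      - expectation F * G \<omega> + expectation F * expectation G)"
    unfolding covariance_def by (simp add: algebra_simps)
  also have "\<dots> = expectation (\<lambda>\<omega>. F \<omega> * G \<omega>) - expectation F * expectation G"
    by (simp add: prob_space)
  finally show ?thesis .
qed

lemma cov_exists_uminus: "cov_exists (\<lambda>\<omega>. - F \<omega>) (\<lambda>\<omega>. - G \<omega>) \<longleftrightarrow> cov_exists F G"
  by (simp add: cov_exists_def)

lemma covariance_uminus: "covariance (\<lambda>\<omega>. - F \<omega>) (\<lambda>\<omega>. - G \<omega>) = covariance F G"
proof -
  have "(\<lambda>\<omega>. (- F \<omega> - expectation (\<lambda>\<omega>. - F \<omega>)) * (- G \<omega> - expectation (\<lambda>\<omega>. - G \<omega>)))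
      = (\<lambda>\<omega>. (F \<omega> - expectation F) * (G \<omega> - expectation G))"
    by (simp add: algebra_simps)
  then show ?thesis
    by (simp add: covariance_def)
qed

section \<open>Closure of negative association under monotone maps and negation\<close>

text \<open>A nondecreasing test function of the transformed variables is a nondecreasing test
  function of the original ones, so \<open>F I f\<close> and \<open>F J g\<close> absorb the maps.
  The map may vary with the index, which lets nonnegative weights in; clipping and centring are the
  other uses.\<close>

lemma neg_assoc_comp_mono:
  assumes "neg_assoc T X" and \<phi>: "\<And>i. mono (\<phi> i)"
  shows "neg_assoc T (\<lambda>i \<omega>. \<phi> i (X i \<omega>))"
  unfolding neg_assoc_def neg_assoc_finite_def
proof (intro allI impI)
  fix L I J :: "'b set" and f g :: "('b \<Rightarrow> real) \<Rightarrow> real"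
  assume *: "finite L" "L \<subseteq> T" "I \<subseteq> L" "J \<subseteq> L" "I \<inter> J = {}"
    and f: "mono_on (I \<rightarrow>\<^sub>E UNIV) f" and g: "mono_on (J \<rightarrow>\<^sub>E UNIV) g"
    and cov: "cov_exists (\<lambda>\<omega>. f (\<lambda>k\<in>I. \<phi> k (X k \<omega>))) (\<lambda>\<omega>. g (\<lambda>k\<in>J. \<phi> k (X k \<omega>)))"
  define F where "F S h x = h (\<lambda>k\<in>S. \<phi> k (x k))" for S :: "'b set" and h :: "('b \<Rightarrow> real) \<Rightarrow> real" and x
  have F: "mono_on (S \<rightarrow>\<^sub>E UNIV) (F S h)" if h: "mono_on (S \<rightarrow>\<^sub>E UNIV) h" for S h
    unfolding F_def
    by (rule mono_onI, rule mono_onD[OF h]) (auto simp: le_fun_def intro: monoD[OF \<phi>])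
  have eq: "F S h (\<lambda>k\<in>S. X k \<omega>) = h (\<lambda>k\<in>S. \<phi> k (X k \<omega>))" for S h \<omega>
    unfolding F_def by (rule arg_cong[where f = h]) (auto simp: restrict_def)
  have "covariance (\<lambda>\<omega>. F I f (\<lambda>k\<in>I. X k \<omega>)) (\<lambda>\<omega>. F J g (\<lambda>k\<in>J. X k \<omega>)) \<le> 0"
    by (rule neg_assocD[OF assms(1)], unfold eq)
      (use * F[OF f] F[OF g] cov in \<open>auto intro: finite_subset\<close>)
  then show "covariance (\<lambda>\<omega>. f (\<lambda>k\<in>I. \<phi> k (X k \<omega>))) (\<lambda>\<omega>. g (\<lambda>k\<in>J. \<phi> k (X k \<omega>))) \<le> 0"
    by (simp add: eq)
qed

text \<open>Reflecting the arguments makes \<open>h\<close> nonincreasing, and the outer sign in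
  \<open>F\<close> makes it nondecreasing again. The two outer signs cancel in the
  covariance.\<close>

lemma neg_assoc_uminus:
  assumes "neg_assoc T X"
  shows "neg_assoc T (\<lambda>i \<omega>. - X i \<omega>)"
  unfolding neg_assoc_def neg_assoc_finite_def
proof (intro allI impI)
  fix L I J :: "'b set" and f g :: "('b \<Rightarrow> real) \<Rightarrow> real"
  assume *: "finite L" "L \<subseteq> T" "I \<subseteq> L" "J \<subseteq> L" "I \<inter> J = {}"
    and f: "mono_on (I \<rightarrow>\<^sub>E UNIV) f" and g: "mono_on (J \<rightarrow>\<^sub>E UNIV) g"
    and cov: "cov_exists (\<lambda>\<omega>. f (\<lambda>k\<in>I. - X k \<omega>)) (\<lambda>\<omega>. g (\<lambda>k\<in>J. - X k \<omega>))"
  define F where "F S h x = - h (\<lambda>k\<in>S. - x k)" for S :: "'b set" and h :: "('b \<Rightarrow> real) \<Rightarrow> real" and x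
  have F: "mono_on (S \<rightarrow>\<^sub>E UNIV) (F S h)" if h: "mono_on (S \<rightarrow>\<^sub>E UNIV) h" for S h
    unfolding F_def
    by (rule mono_onI, rule le_imp_neg_le, rule mono_onD[OF h]) (auto simp: le_fun_def)
  have eq: "F S h (\<lambda>k\<in>S. X k \<omega>) = - h (\<lambda>k\<in>S. - X k \<omega>)" for S h \<omega>
    unfolding F_def by (simp, rule arg_cong[where f = h]) (auto simp: restrict_def)
  have "covariance (\<lambda>\<omega>. F I f (\<lambda>k\<in>I. X k \<omega>)) (\<lambda>\<omega>. F J g (\<lambda>k\<in>J. X k \<omega>)) \<le> 0"
    by (rule neg_assocD[OF assms(1)], unfold eq cov_exists_uminus)
      (use * F[OF f] F[OF g] cov in \<open>auto intro: finite_subset\<close>)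
  then show "covariance (\<lambda>\<omega>. f (\<lambda>k\<in>I. - X k \<omega>)) (\<lambda>\<omega>. g (\<lambda>k\<in>J. - X k \<omega>)) \<le> 0"
    by (simp add: eq covariance_uminus)
qed

text \<open>One index is split off at a time: the negated indicators of \<open>A\<close> and
  \<open>B\<close> are nondecreasing functions of disjoint sets of coordinates, and their
  nonpositive covariance says that P(A and B) is at most P(A) P(B). This product bound replaces
  independence in the second Borel-Cantelli lemma.\<close>

lemma neg_assoc_prob_le_prod:
  assumes X: "neg_assoc T X" and meas: "\<And>i. i \<in> I \<Longrightarrow> X i \<in> borel_measurable M"
    and I: "finite I" "I \<subseteq> T"
  shows "prob {\<omega> \<in> space M. \<forall>i\<in>I. X i \<omega> \<le> c i} \<le> (\<Prod>i\<in>I. prob {\<omega> \<in> space M. X i \<omega> \<le> c i})"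
  using I meas
proof (induction I rule: finite_induct)
  case empty
  then show ?case by (simp add: prob_space)
next
  case (insert j I)
  have [measurable]: "X j \<in> borel_measurable M" "\<And>i. i \<in> I \<Longrightarrow> X i \<in> borel_measurable M"
    using insert by auto
  define f :: "('b \<Rightarrow> real) \<Rightarrow> real" where "f x = - of_bool (x j \<le> c j)" for x
  define g :: "('b \<Rightarrow> real) \<Rightarrow> real" where "g x = - of_bool (\<forall>i\<in>I. x i \<le> c i)" for x
  let ?F = "\<lambda>\<omega>. f (\<lambda>k\<in>{j}. X k \<omega>)" and ?G = "\<lambda>\<omega>. g (\<lambda>k\<in>I. X k \<omega>)"
  define A where "A = {\<omega> \<in> space M. X j \<omega> \<le> c j}"
  define B where "B = {\<omega> \<in> space M. \<forall>i\<in>I. X i \<omega> \<le> c i}"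
  have [measurable]: "A \<in> events" "B \<in> events"
    unfolding A_def B_def using \<open>finite I\<close> by auto
  have int: "integrable M (\<lambda>\<omega>. - indicat_real A \<omega>)" "integrable M (\<lambda>\<omega>. - indicat_real B \<omega>)"
      "integrable M (indicat_real (A \<inter> B))"
    by (auto intro!: integrable_real_indicator simp: emeasure_eq_measure)
  \<comment> \<open>The sets \<open>A\<close> and \<open>B\<close> lie in \<open>space M\<close>, so
    these identities hold only there; integrability and expectations are therefore transferred by
    congruence.\<close>
  have F: "?F \<omega> = - indicat_real A \<omega>" and G: "?G \<omega> = - indicat_real B \<omega>"
    and FG: "?F \<omega> * ?G \<omega> = indicat_real (A \<inter> B) \<omega>" if "\<omega> \<in> space M" for \<omega>
    using that by (auto simp: f_def g_def A_def B_def indicator_def)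
  have "integrable M ?F \<longleftrightarrow> integrable M (\<lambda>\<omega>. - indicat_real A \<omega>)"
    by (rule Bochner_Integration.integrable_cong[OF refl F])
  moreover have "integrable M ?G \<longleftrightarrow> integrable M (\<lambda>\<omega>. - indicat_real B \<omega>)"
    by (rule Bochner_Integration.integrable_cong[OF refl G])
  moreover have "integrable M (\<lambda>\<omega>. ?F \<omega> * ?G \<omega>) \<longleftrightarrow> integrable M (indicat_real (A \<inter> B))"
    by (rule Bochner_Integration.integrable_cong[OF refl FG])
  ultimately have cov: "cov_exists ?F ?G"
    using int unfolding cov_exists_def by blast
  have "covariance ?F ?G \<le> 0"
  proof (rule neg_assocD[OF X _ _ _ _ _ _ _ cov])
    show "mono_on ({j} \<rightarrow>\<^sub>E UNIV) f" "mono_on (I \<rightarrow>\<^sub>E UNIV) g"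
      by (auto simp: mono_on_def f_def g_def le_fun_def intro: order_trans)
  qed (use insert in auto)
  moreover have "expectation ?F = expectation (\<lambda>\<omega>. - indicat_real A \<omega>)"
    by (rule Bochner_Integration.integral_cong[OF refl F])
  moreover have "expectation ?G = expectation (\<lambda>\<omega>. - indicat_real B \<omega>)"
    by (rule Bochner_Integration.integral_cong[OF refl G])
  moreover have "expectation (\<lambda>\<omega>. ?F \<omega> * ?G \<omega>) = expectation (indicat_real (A \<inter> B))"
    by (rule Bochner_Integration.integral_cong[OF refl FG])
  ultimately have "prob (A \<inter> B) \<le> prob A * prob B"
    by (simp add: covariance_eq[OF cov])
  also have "prob B \<le> (\<Prod>i\<in>I. prob {\<omega> \<in> space M. X i \<omega> \<le> c i})"
    unfolding B_def using insert by auto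
  then have "prob A * prob B \<le> prob A * (\<Prod>i\<in>I. prob {\<omega> \<in> space M. X i \<omega> \<le> c i})"
    by (simp add: mult_left_mono)
  finally have "prob (A \<inter> B) \<le> (\<Prod>i\<in>insert j I. prob {\<omega> \<in> space M. X i \<omega> \<le> c i})"
    using insert by (simp add: A_def)
  moreover have "A \<inter> B = {\<omega> \<in> space M. \<forall>i\<in>insert j I. X i \<omega> \<le> c i}"
    by (auto simp: A_def B_def)
  ultimately show ?case by simp
qed

end

section \<open>Maximal inequality for partial sums\<close>

text \<open>This is the largest of the sums \<open>x k + ... + x (k + j - 1)\<close> for j from 0 to
  m, the empty sum included. The recursion separates \<open>x k\<close> from a nondecreasing
  function of the later coordinates, the shape to which negative association applies.\<close>

fun max_tail_sum :: "nat \<Rightarrow> nat \<Rightarrow> (nat \<Rightarrow> real) \<Rightarrow> real" where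
  "max_tail_sum 0 k x = 0"
| "max_tail_sum (Suc m) k x = max 0 (x k + max_tail_sum m (Suc k) x)"

lemma max_tail_sum_nonneg: "0 \<le> max_tail_sum m k x"
  by (cases m) auto

lemma max_tail_sum_mono:
  "(\<And>i. k \<le> i \<Longrightarrow> i < k + m \<Longrightarrow> x i \<le> y i) \<Longrightarrow> max_tail_sum m k x \<le> max_tail_sum m k y"
proof (induction m arbitrary: k)
  case (Suc m)
  have "max_tail_sum m (Suc k) x \<le> max_tail_sum m (Suc k) y"
    by (rule Suc.IH) (simp add: Suc.prems)
  moreover have "x k \<le> y k"
    by (simp add: Suc.prems)
  ultimately show ?case
    unfolding max_tail_sum.simps by (intro max.mono add_mono) simp_all
qed simp

lemma max_tail_sum_cong:
  "(\<And>i. k \<le> i \<Longrightarrow> i < k + m \<Longrightarrow> x i = y i) \<Longrightarrow> max_tail_sum m k x = max_tail_sum m k y"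
  by (intro antisym max_tail_sum_mono) simp_all

lemma sum_le_max_tail_sum:
  "j \<le> m \<Longrightarrow> (\<Sum>i=k..<k + j. x i) \<le> max_tail_sum m k x"
proof (induction m arbitrary: k j)
  case (Suc m)
  show ?case
  proof (cases j)
    case j: (Suc j')
    have "(\<Sum>i=k..<k + j. x i) = x k + (\<Sum>i=Suc k..<Suc k + j'. x i)"
      using j sum.atLeast_Suc_lessThan[of k "k + j" x] by simp
    also have "(\<Sum>i=Suc k..<Suc k + j'. x i) \<le> max_tail_sum m (Suc k) x"
      using Suc.prems by (intro Suc.IH) (simp add: j)
    finally show ?thesis by simp
  qed (simp add: max_tail_sum_nonneg del: max_tail_sum.simps)
qed simp

context prob_space
begin

lemma integrable_mult_squares:
  fixes F G :: "'a \<Rightarrow> real"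
  assumes [measurable]: "F \<in> borel_measurable M" "G \<in> borel_measurable M"
    and "integrable M (\<lambda>\<omega>. (F \<omega>)\<^sup>2)" "integrable M (\<lambda>\<omega>. (G \<omega>)\<^sup>2)"
  shows "integrable M (\<lambda>\<omega>. F \<omega> * G \<omega>)"
proof (rule Bochner_Integration.integrable_bound)
  show "integrable M (\<lambda>\<omega>. (F \<omega>)\<^sup>2 + (G \<omega>)\<^sup>2)"
    using assms by simp
  have "\<bar>x * y\<bar> \<le> x\<^sup>2 + y\<^sup>2" for x y :: real
  proof -
    have "2 * \<bar>x * y\<bar> \<le> x\<^sup>2 + y\<^sup>2"
      using sum_squares_bound[of "\<bar>x\<bar>" "\<bar>y\<bar>"] by (simp add: abs_mult)
    then show ?thesis by linarith
  qed
  then show "AE \<omega> in M. norm (F \<omega> * G \<omega>) \<le> norm ((F \<omega>)\<^sup>2 + (G \<omega>)\<^sup>2)"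
    by simp
qed measurable

lemma max_tail_sum_measurable:
  assumes "\<And>i. k \<le> i \<Longrightarrow> Z i \<in> borel_measurable M"
  shows "(\<lambda>\<omega>. max_tail_sum m k (\<lambda>i. Z i \<omega>)) \<in> borel_measurable M"
  using assms
proof (induction m arbitrary: k)
  case (Suc m)
  have [measurable]: "Z k \<in> borel_measurable M"
      "(\<lambda>\<omega>. max_tail_sum m (Suc k) (\<lambda>i. Z i \<omega>)) \<in> borel_measurable M"
    using Suc by auto
  show ?case by simp
qed simp

text \<open>Dropping the positive part and expanding the square leaves a cross term
  \<open>Z k * T\<close>. As \<open>Z k\<close> has mean 0, its expectation is a covariance of
  nondecreasing functions of disjoint blocks, hence nonpositive. Square integrability is part of the
  induction because the cross term has to exist.\<close>

lemma neg_assoc_max_tail_sum: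
  assumes Z: "neg_assoc {1..} Z" and meas: "\<And>i. i \<ge> 1 \<Longrightarrow> Z i \<in> borel_measurable M"
    and sq: "\<And>i. i \<ge> 1 \<Longrightarrow> integrable M (\<lambda>\<omega>. (Z i \<omega>)\<^sup>2)"
    and mean: "\<And>i. i \<ge> 1 \<Longrightarrow> expectation (Z i) = 0"
    and "1 \<le> k"
  shows "integrable M (\<lambda>\<omega>. (max_tail_sum m k (\<lambda>i. Z i \<omega>))\<^sup>2)
    \<and> expectation (\<lambda>\<omega>. (max_tail_sum m k (\<lambda>i. Z i \<omega>))\<^sup>2)
      \<le> (\<Sum>i=k..<k + m. expectation (\<lambda>\<omega>. (Z i \<omega>)\<^sup>2))"
  using \<open>1 \<le> k\<close>
proof (induction m arbitrary: k)
  case (Suc m)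
  define T where "T = (\<lambda>\<omega>. max_tail_sum m (Suc k) (\<lambda>i. Z i \<omega>))"
  have [measurable]: "Z k \<in> borel_measurable M" "T \<in> borel_measurable M"
    unfolding T_def using meas Suc.prems by (auto intro!: max_tail_sum_measurable)
  have T: "integrable M (\<lambda>\<omega>. (T \<omega>)\<^sup>2)"
      "expectation (\<lambda>\<omega>. (T \<omega>)\<^sup>2) \<le> (\<Sum>i=Suc k..<Suc k + m. expectation (\<lambda>\<omega>. (Z i \<omega>)\<^sup>2))"
    using Suc.IH[of "Suc k"] by (auto simp: T_def)
  have Zk: "integrable M (\<lambda>\<omega>. (Z k \<omega>)\<^sup>2)"
    using sq Suc.prems by simp
  have ints: "integrable M (\<lambda>\<omega>. Z k \<omega> * T \<omega>)" "integrable M (Z k)" "integrable M T"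
    by (rule integrable_mult_squares[OF _ _ Zk T(1)], measurable)
      (rule square_integrable_imp_integrable[OF _ Zk] square_integrable_imp_integrable[OF _ T(1)],
        measurable)+
  \<comment> \<open>\<open>T\<close> reads only these m coordinates, so it is a function of the
    block disjoint from k.\<close>
  have T_restrict: "max_tail_sum m (Suc k) (\<lambda>i\<in>{Suc k..<Suc k + m}. Z i \<omega>) = T \<omega>" for \<omega>
    unfolding T_def by (rule max_tail_sum_cong) simp
  have "covariance (\<lambda>\<omega>. (\<lambda>x. x k) (\<lambda>i\<in>{k}. Z i \<omega>))
      (\<lambda>\<omega>. max_tail_sum m (Suc k) (\<lambda>i\<in>{Suc k..<Suc k + m}. Z i \<omega>)) \<le> 0"
  proof (rule neg_assocD[OF Z])
    show "mono_on ({k} \<rightarrow>\<^sub>E UNIV) (\<lambda>x::nat \<Rightarrow> real. x k)"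
      by (auto simp: mono_on_def le_fun_def)
    show "mono_on ({Suc k..<Suc k + m} \<rightarrow>\<^sub>E UNIV) (max_tail_sum m (Suc k))"
      by (auto simp: mono_on_def le_fun_def intro!: max_tail_sum_mono)
    show "cov_exists (\<lambda>\<omega>. (\<lambda>x. x k) (\<lambda>i\<in>{k}. Z i \<omega>))
      (\<lambda>\<omega>. max_tail_sum m (Suc k) (\<lambda>i\<in>{Suc k..<Suc k + m}. Z i \<omega>))"
      unfolding T_restrict using ints by (simp add: cov_exists_def)
  qed (use Suc.prems in auto)
  then have "covariance (Z k) T \<le> 0"
    unfolding T_restrict by simp
  moreover have "cov_exists (Z k) T"
    using ints by (simp add: cov_exists_def)
  ultimately have cross: "expectation (\<lambda>\<omega>. Z k \<omega> * T \<omega>) \<le> 0"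
    using covariance_eq[of "Z k" T] mean[of k] Suc.prems by simp
  have sq_int: "integrable M (\<lambda>\<omega>. (Z k \<omega>)\<^sup>2 + 2 * (Z k \<omega> * T \<omega>) + (T \<omega>)\<^sup>2)"
    using Zk T ints by simp
  have le: "(max_tail_sum (Suc m) k (\<lambda>i. Z i \<omega>))\<^sup>2 \<le> (Z k \<omega>)\<^sup>2 + 2 * (Z k \<omega> * T \<omega>) + (T \<omega>)\<^sup>2" for \<omega>
  proof -
    have "(max 0 y)\<^sup>2 \<le> y\<^sup>2" for y :: real
      by (auto simp: max_def)
    from this[of "Z k \<omega> + T \<omega>"] show ?thesis
      by (simp add: T_def power2_sum)
  qed
  have int: "integrable M (\<lambda>\<omega>. (max_tail_sum (Suc m) k (\<lambda>i. Z i \<omega>))\<^sup>2)"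
  proof (rule Bochner_Integration.integrable_bound[OF sq_int])
    show "(\<lambda>\<omega>. (max_tail_sum (Suc m) k (\<lambda>i. Z i \<omega>))\<^sup>2) \<in> borel_measurable M"
      using meas Suc.prems by (intro borel_measurable_power max_tail_sum_measurable) auto
    show "AE \<omega> in M. norm ((max_tail_sum (Suc m) k (\<lambda>i. Z i \<omega>))\<^sup>2)
      \<le> norm ((Z k \<omega>)\<^sup>2 + 2 * (Z k \<omega> * T \<omega>) + (T \<omega>)\<^sup>2)"
    proof (rule AE_I2)
      fix \<omega>
      show "norm ((max_tail_sum (Suc m) k (\<lambda>i. Z i \<omega>))\<^sup>2)
        \<le> norm ((Z k \<omega>)\<^sup>2 + 2 * (Z k \<omega> * T \<omega>) + (T \<omega>)\<^sup>2)"
        unfolding real_norm_def abs_power2 by (rule order_trans[OF le abs_ge_self])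
    qed
  qed
  have "expectation (\<lambda>\<omega>. (max_tail_sum (Suc m) k (\<lambda>i. Z i \<omega>))\<^sup>2)
      \<le> expectation (\<lambda>\<omega>. (Z k \<omega>)\<^sup>2 + 2 * (Z k \<omega> * T \<omega>) + (T \<omega>)\<^sup>2)"
    by (rule integral_mono[OF int sq_int le])
  also have "\<dots> = expectation (\<lambda>\<omega>. (Z k \<omega>)\<^sup>2) + 2 * expectation (\<lambda>\<omega>. Z k \<omega> * T \<omega>)
      + expectation (\<lambda>\<omega>. (T \<omega>)\<^sup>2)"
    using Zk T ints by simp
  also have "\<dots> \<le> expectation (\<lambda>\<omega>. (Z k \<omega>)\<^sup>2)
      + (\<Sum>i=Suc k..<Suc k + m. expectation (\<lambda>\<omega>. (Z i \<omega>)\<^sup>2))"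
    using cross T(2) by linarith
  also have "\<dots> = (\<Sum>i=k..<k + Suc m. expectation (\<lambda>\<omega>. (Z i \<omega>)\<^sup>2))"
    using sum.atLeast_Suc_lessThan[of k "k + Suc m" "\<lambda>i. expectation (\<lambda>\<omega>. (Z i \<omega>)\<^sup>2)"] by simp
  finally show ?case
    using int by blast
qed simp

text \<open>The largest partial sums of Z and of -Z together control the absolute value. Markov's
  inequality for the sum of their squares produces the factor 2.\<close>

lemma neg_assoc_maximal_inequality:
  fixes Z :: "nat \<Rightarrow> 'a \<Rightarrow> real" and n :: nat
  assumes Z: "neg_assoc {1..} Z" and meas: "\<And>i. i \<ge> 1 \<Longrightarrow> Z i \<in> borel_measurable M"
    and sq: "\<And>i. i \<ge> 1 \<Longrightarrow> integrable M (\<lambda>\<omega>. (Z i \<omega>)\<^sup>2)"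
    and mean: "\<And>i. i \<ge> 1 \<Longrightarrow> expectation (Z i) = 0"
    and t: "t > 0"
  shows "prob {\<omega> \<in> space M. \<exists>k\<in>{1..n}. \<bar>\<Sum>i=1..k. Z i \<omega>\<bar> > t}
    \<le> 2 / t\<^sup>2 * (\<Sum>i=1..n. expectation (\<lambda>\<omega>. (Z i \<omega>)\<^sup>2))" (is "prob ?A \<le> _ * ?s")
proof -
  define T where "T \<omega> = max_tail_sum n 1 (\<lambda>i. Z i \<omega>)" for \<omega>
  define T' where "T' \<omega> = max_tail_sum n 1 (\<lambda>i. - Z i \<omega>)" for \<omega>
  have T: "integrable M (\<lambda>\<omega>. (T \<omega>)\<^sup>2)" "expectation (\<lambda>\<omega>. (T \<omega>)\<^sup>2) \<le> ?s"
    using neg_assoc_max_tail_sum[OF Z meas sq mean, of 1 n]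
    by (auto simp: T_def atLeastLessThanSuc_atLeastAtMost)
  have T': "integrable M (\<lambda>\<omega>. (T' \<omega>)\<^sup>2)" "expectation (\<lambda>\<omega>. (T' \<omega>)\<^sup>2) \<le> ?s"
    using neg_assoc_max_tail_sum[OF neg_assoc_uminus[OF Z], of 1 n] meas sq mean
    by (auto simp: T'_def atLeastLessThanSuc_atLeastAtMost)
  have [measurable]: "T \<in> borel_measurable M" "T' \<in> borel_measurable M"
    unfolding T_def[abs_def] T'_def[abs_def]
    using meas by (intro max_tail_sum_measurable; simp)+
  let ?W = "\<lambda>\<omega>. (T \<omega>)\<^sup>2 + (T' \<omega>)\<^sup>2"
  have W: "integrable M ?W"
    using T T' by simp
  have "?A \<subseteq> {\<omega> \<in> space M. t\<^sup>2 \<le> ?W \<omega>}"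
  proof safe
    fix \<omega> k assume "\<omega> \<in> space M" and k: "k \<in> {1..n}" and gt: "t < \<bar>\<Sum>i=1..k. Z i \<omega>\<bar>"
    have "(\<Sum>i=1..k. Z i \<omega>) \<le> T \<omega>" "(\<Sum>i=1..k. - Z i \<omega>) \<le> T' \<omega>"
      using sum_le_max_tail_sum[of k n "\<lambda>i. Z i \<omega>" 1]
        sum_le_max_tail_sum[of k n "\<lambda>i. - Z i \<omega>" 1] k
      by (simp_all add: T_def T'_def atLeastLessThanSuc_atLeastAtMost)
    then have "t < T \<omega> \<or> t < T' \<omega>"
      using gt unfolding sum_negf by linarith
    then have "t\<^sup>2 \<le> (T \<omega>)\<^sup>2 \<or> t\<^sup>2 \<le> (T' \<omega>)\<^sup>2"
      using t by (auto intro!: power_mono)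
    then show "t\<^sup>2 \<le> ?W \<omega>"
      using zero_le_power2[of "T \<omega>"] zero_le_power2[of "T' \<omega>"] by linarith
  qed
  then have "prob ?A \<le> prob {\<omega> \<in> space M. t\<^sup>2 \<le> ?W \<omega>}"
    by (intro finite_measure_mono) measurable
  also have "\<dots> \<le> expectation ?W / t\<^sup>2"
    using t W by (intro integral_Markov_inequality_measure[where A = "{}"]) auto
  also have "\<dots> \<le> (2 * ?s) / t\<^sup>2"
    using T T' by (intro divide_right_mono) auto
  finally show ?thesis by simp
qed

text \<open>Multiplication by a negative weight is not monotone, so the weights are split into
  positive and negative parts. Each part is tested at level t / 2, which turns the constant 2 into
  8; the two sums of squares recombine because one of the two parts always vanishes.\<close>

lemma neg_assoc_weighted_maximal_inequality:
  fixes Z :: "nat \<Rightarrow> 'a \<Rightarrow> real" and n :: nat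
  assumes Z: "neg_assoc {1..} Z" and meas: "\<And>i. i \<ge> 1 \<Longrightarrow> Z i \<in> borel_measurable M"
    and sq: "\<And>i. i \<ge> 1 \<Longrightarrow> integrable M (\<lambda>\<omega>. (Z i \<omega>)\<^sup>2)"
    and mean: "\<And>i. i \<ge> 1 \<Longrightarrow> expectation (Z i) = 0"
    and t: "t > 0"
  shows "prob {\<omega> \<in> space M. \<exists>k\<in>{1..n}. \<bar>\<Sum>i=1..k. a i * Z i \<omega>\<bar> > t}
    \<le> 8 / t\<^sup>2 * (\<Sum>i=1..n. (a i)\<^sup>2 * expectation (\<lambda>\<omega>. (Z i \<omega>)\<^sup>2))" (is "prob ?A \<le> _")
proof -
  let ?E = "\<lambda>w. {\<omega> \<in> space M. \<exists>k\<in>{1..n}. \<bar>\<Sum>i=1..k. w i * Z i \<omega>\<bar> > t / 2}"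
  have E: "?E w \<in> events" for w
  proof -
    have [measurable]: "(\<lambda>\<omega>. \<Sum>i=1..k. w i * Z i \<omega>) \<in> borel_measurable M" for k
      using meas by (intro borel_measurable_sum borel_measurable_times) auto
    show ?thesis by measurable
  qed
  have *: "prob (?E w) \<le> 8 / t\<^sup>2 * (\<Sum>i=1..n. (w i)\<^sup>2 * expectation (\<lambda>\<omega>. (Z i \<omega>)\<^sup>2))"
    if "\<And>i. w i \<ge> 0" for w
  proof -
    have na: "neg_assoc {1..} (\<lambda>i \<omega>. w i * Z i \<omega>)"
      using neg_assoc_comp_mono[OF Z, of "\<lambda>i x. w i * x"] that
      by (auto simp: mono_def mult_left_mono)
    show ?thesis
      using neg_assoc_maximal_inequality[OF na, of "t / 2" n] meas sq mean t
      by (simp add: power_mult_distrib power_divide)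
  qed
  have "?A \<subseteq> ?E (\<lambda>i. max 0 (a i)) \<union> ?E (\<lambda>i. max 0 (- a i))"
  proof safe
    fix \<omega> k assume \<omega>: "\<omega> \<in> space M" and k: "k \<in> {1..n}" and gt: "t < \<bar>\<Sum>i=1..k. a i * Z i \<omega>\<bar>"
      and nex: "\<not> (\<exists>k\<in>{1..n}. t / 2 < \<bar>\<Sum>i=1..k. max 0 (- a i) * Z i \<omega>\<bar>)"
    have "(\<Sum>i=1..k. a i * Z i \<omega>)
        = (\<Sum>i=1..k. max 0 (a i) * Z i \<omega>) - (\<Sum>i=1..k. max 0 (- a i) * Z i \<omega>)"
      unfolding sum_subtractf[symmetric]
      by (intro sum.cong refl) (simp add: max_def)
    moreover have "\<bar>\<Sum>i=1..k. max 0 (- a i) * Z i \<omega>\<bar> \<le> t / 2"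
      using nex k by (metis not_less)
    moreover have "t / 2 < \<bar>v\<bar>" if "u = v - w" "t < \<bar>u\<bar>" "\<bar>w\<bar> \<le> t / 2" for u v w :: real
      using that by linarith
    ultimately have "t / 2 < \<bar>\<Sum>i=1..k. max 0 (a i) * Z i \<omega>\<bar>"
      using gt by metis
    then show "\<exists>k\<in>{1..n}. t / 2 < \<bar>\<Sum>i=1..k. max 0 (a i) * Z i \<omega>\<bar>"
      using k by blast
  qed
  then have "prob ?A \<le> prob (?E (\<lambda>i. max 0 (a i)) \<union> ?E (\<lambda>i. max 0 (- a i)))"
    by (rule finite_measure_mono) (intro sets.Un E)
  also have "\<dots> \<le> prob (?E (\<lambda>i. max 0 (a i))) + prob (?E (\<lambda>i. max 0 (- a i)))"
    by (intro measure_Un_le E)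
  also have "\<dots> \<le> 8 / t\<^sup>2 * ((\<Sum>i=1..n. (max 0 (a i))\<^sup>2 * expectation (\<lambda>\<omega>. (Z i \<omega>)\<^sup>2))
      + (\<Sum>i=1..n. (max 0 (- a i))\<^sup>2 * expectation (\<lambda>\<omega>. (Z i \<omega>)\<^sup>2)))"
    unfolding distrib_left by (intro add_mono *) simp_all
  also have "(\<Sum>i=1..n. (max 0 (a i))\<^sup>2 * expectation (\<lambda>\<omega>. (Z i \<omega>)\<^sup>2))
      + (\<Sum>i=1..n. (max 0 (- a i))\<^sup>2 * expectation (\<lambda>\<omega>. (Z i \<omega>)\<^sup>2))
      = (\<Sum>i=1..n. (a i)\<^sup>2 * expectation (\<lambda>\<omega>. (Z i \<omega>)\<^sup>2))"
    unfolding sum.distrib[symmetric] by (intro sum.cong refl) (simp add: max_def)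
  finally show ?thesis .
qed

end

section \<open>Norming sequences of regular growth\<close>

text \<open>Two-sided power growth. The exponent p above 1/2 makes the tails of the series of 1 / (b
  n)^2 small enough, and \<beta> below 1 makes b n negligible against n. Indices start at 2 because
  the intended sequence has a logarithmic factor that vanishes at 1.\<close>

locale norming =
  fixes b :: "nat \<Rightarrow> real" and p \<beta> K :: real
  assumes pos_2: "0 < b 2"
    and lower: "2 \<le> n \<Longrightarrow> n \<le> m \<Longrightarrow> (real m / real n) powr p * b n \<le> b m"
    and upper: "2 \<le> n \<Longrightarrow> n \<le> m \<Longrightarrow> b m \<le> K * (real m / real n) powr \<beta> * b n"
    and p_gt: "1 / 2 < p" and \<beta>_less: "\<beta> < 1"
begin

lemma pos: "2 \<le> n \<Longrightarrow> 0 < b n"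
  by (rule less_le_trans[OF _ lower[of 2 n]]) (simp_all add: pos_2)

lemma K_ge_1: "1 \<le> K"
  using upper[of 2 2] pos_2 by simp

lemma mono: "2 \<le> n \<Longrightarrow> n \<le> m \<Longrightarrow> b n \<le> b m"
proof -
  assume nm: "2 \<le> n" "n \<le> m"
  have "1 \<le> (real m / real n) powr p"
    using nm p_gt by (intro ge_one_powr_ge_zero) auto
  then have "1 * b n \<le> (real m / real n) powr p * b n"
    using pos[of n] nm by (intro mult_right_mono) auto
  then show ?thesis
    using lower[OF nm] by simp
qed

lemma upper_linear: "2 \<le> n \<Longrightarrow> n \<le> m \<Longrightarrow> b m \<le> K * (real m / real n) * b n"
proof -
  assume nm: "2 \<le> n" "n \<le> m"
  have "(real m / real n) powr \<beta> \<le> (real m / real n) powr 1"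
    using nm \<beta>_less by (intro powr_mono) auto
  then have "K * (real m / real n) powr \<beta> * b n \<le> K * (real m / real n) * b n"
    using pos[of n] nm K_ge_1 by (intro mult_right_mono mult_left_mono) auto
  then show ?thesis
    using upper[OF nm] by simp
qed

lemma tendsto_ratio_at_top: "filterlim (\<lambda>n. real n / b n) at_top sequentially"
proof (rule filterlim_at_top_mono)
  \<comment> \<open>The reciprocal of the constant in the bound of \<open>b n\<close> by a multiple
    of \<open>real n powr \<beta>\<close>, obtained by comparison with index 2.\<close>
  define D where "D = 2 powr \<beta> / (K * b 2)"
  have D: "D > 0"
    using K_ge_1 pos_2 by (simp add: D_def)
  have "filterlim (\<lambda>n. real n powr (1 - \<beta>)) at_top sequentially"
    using \<beta>_less filterlim_compose[OF real_powr_at_top filterlim_real_sequentially, of "1 - \<beta>"] by simp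
  then show "filterlim (\<lambda>n. D * real n powr (1 - \<beta>)) at_top sequentially"
    by (rule filterlim_tendsto_pos_mult_at_top[OF tendsto_const D])
  have "D * real n powr (1 - \<beta>) \<le> real n / b n" if n: "2 \<le> n" for n
  proof -
    have "b n * (D * real n powr (1 - \<beta>)) \<le> K * (real n / 2) powr \<beta> * b 2 * (D * real n powr (1 - \<beta>))"
      using upper[of 2 n] n D by (intro mult_right_mono) auto
    also have "\<dots> = real n"
      using K_ge_1 pos_2 n by (simp add: D_def powr_divide powr_diff)
    finally show ?thesis
      using pos[OF n] by (simp add: field_simps)
  qed
  then show "eventually (\<lambda>n. D * real n powr (1 - \<beta>) \<le> real n / b n) sequentially"
    by (auto simp: eventually_at_top_linorder)
qed

lemma exists_ge: "\<exists>n\<ge>2. x \<le> b n"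
proof -
  have "filterlim (\<lambda>n. (real n / 2) powr p * b 2) at_top sequentially"
  proof (rule filterlim_at_top_mult_tendsto_pos[OF tendsto_const pos_2])
    have "filterlim (\<lambda>n. (1 / 2) * real n) at_top sequentially"
      by (rule filterlim_tendsto_pos_mult_at_top[OF tendsto_const _ filterlim_real_sequentially]) simp
    then show "filterlim (\<lambda>n. (real n / 2) powr p) at_top sequentially"
      using p_gt filterlim_compose[OF real_powr_at_top, of p "\<lambda>n. (1 / 2) * real n"] by simp
  qed
  then have "eventually (\<lambda>n. x \<le> (real n / 2) powr p * b 2 \<and> 2 \<le> n) sequentially"
    by (intro eventually_conj eventually_ge_at_top) (simp add: filterlim_at_top)
  then obtain n where "x \<le> (real n / 2) powr p * b 2" "2 \<le> n"
    using eventually_happens'[OF sequentially_bot] by blast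
  then show ?thesis
    using lower[of 2 n] by auto
qed

section \<open>Generalized inverse of the norming sequence\<close>

text \<open>By monotonicity of \<open>b\<close>, exactly \<open>idx x - 2\<close> indices n from 2
  on satisfy \<open>b n < x\<close>. Hence the expectation of \<open>idx\<close> at the absolute
  value of a variable is, up to a bounded offset, the sum of its tail probabilities at the levels
  \<open>b n\<close>.\<close>

definition idx :: "real \<Rightarrow> nat" where
  "idx x = (LEAST n. 2 \<le> n \<and> x \<le> b n)"

lemma idx_ge_2: "2 \<le> idx x" and le_b_idx: "x \<le> b (idx x)"
  using LeastI_ex[of "\<lambda>n. 2 \<le> n \<and> x \<le> b n"] exists_ge[of x] unfolding idx_def by blast+

lemma less_idx_iff: "2 \<le> n \<Longrightarrow> n < idx x \<longleftrightarrow> b n < x"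
proof
  assume "2 \<le> n" "n < idx x"
  then show "b n < x"
    using not_less_Least[of n "\<lambda>n. 2 \<le> n \<and> x \<le> b n"] unfolding idx_def by auto
next
  assume "2 \<le> n" "b n < x"
  then show "n < idx x"
    using le_b_idx[of x] mono[OF idx_ge_2[of x], of n] by (meson leD leI le_less_trans)
qed

lemma idx_mono: "x \<le> y \<Longrightarrow> idx x \<le> idx y"
  unfolding idx_def[of x] using idx_ge_2[of y] le_b_idx[of y] by (intro Least_le) auto

lemma idx_measurable [measurable]: "(\<lambda>x. real (idx x)) \<in> borel_measurable borel"
  by (rule borel_measurable_mono) (auto simp: mono_def idx_mono)

lemma idx_measurable_count [measurable]: "idx \<in> measurable borel (count_space UNIV)"
proof -
  have "(\<lambda>x. nat \<lfloor>real (idx x)\<rfloor>) \<in> measurable borel (count_space UNIV)"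
    by measurable
  then show ?thesis by simp
qed

text \<open>At most linear growth of \<open>b\<close> makes integrability of \<open>idx\<close>
  imply integrability of the variable itself.\<close>

lemma le_idx: "x \<le> K * b 2 * real (idx x)"
proof -
  have "x \<le> K * (real (idx x) / real 2) * b 2"
    using le_b_idx[of x] upper_linear[OF _ idx_ge_2[of x]] by simp
  also have "\<dots> \<le> K * real (idx x) * b 2"
    using K_ge_1 pos_2 by (intro mult_right_mono mult_left_mono) auto
  finally show ?thesis by (simp add: algebra_simps)
qed

section \<open>Truncation at the norming level\<close>

text \<open>Between n and \<open>idx x\<close> the sequence grows at most linearly, so the excess
  over \<open>b n\<close> is bounded by a quantity in which n cancels; from \<open>idx x\<close> on
  there is no excess. This gives an integrable majorant for dominated convergence.\<close>

lemma excess_bound: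
  assumes "2 \<le> n" "0 \<le> x"
  shows "real n / b n * max 0 (x - b n) \<le> (if n < idx x then K * real (idx x) else 0)"
proof (cases "n < idx x")
  case True
  have "real n / b n * max 0 (x - b n) \<le> real n / b n * b (idx x)"
    using assms pos[of n] le_b_idx[of x] by (intro mult_left_mono) auto
  also have "\<dots> \<le> real n / b n * (K * (real (idx x) / real n) * b n)"
    using assms pos[of n] True by (intro mult_left_mono upper_linear) auto
  also have "\<dots> = K * real (idx x)"
    using assms pos[of n] by simp
  finally show ?thesis using True by simp
next
  case False
  then have "x \<le> b n"
    using less_idx_iff[of n x] assms by auto
  then show ?thesis using False by simp
qed

text \<open>Past \<open>idx x\<close> the lower growth bound makes \<open>x / b n\<close> at most a
  negative power of \<open>n / idx x\<close>. Rounding the quotient down makes the bound constant on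
  blocks of length \<open>idx x\<close>, ready for summation.\<close>

lemma min_ratio_le:
  assumes "2 \<le> n" "0 \<le> x"
  shows "min 1 (x\<^sup>2 / (b n)\<^sup>2) \<le> (if n < idx x then 1 else 0) + real (n div idx x) powr (- 2 * p)"
proof (cases "n < idx x")
  case False
  let ?q = "idx x"
  have q: "0 < ?q" "2 \<le> ?q"
    using idx_ge_2[of x] by auto
  have d: "0 < n div ?q"
    using False q by (simp add: div_greater_zero_iff)
  have "real (n div ?q) \<le> real n / real ?q"
    by (rule of_nat_div_le_of_nat)
  then have "real (n div ?q) powr p \<le> (real n / real ?q) powr p"
    using p_gt by (intro powr_mono2) auto
  then have "real (n div ?q) powr p * b ?q \<le> (real n / real ?q) powr p * b ?q"
    using pos[OF q(2)] by (intro mult_right_mono) auto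
  also have "\<dots> \<le> b n"
    using lower[of ?q n] q False by simp
  finally have "real (n div ?q) powr p * x \<le> b n"
    using mult_left_mono[OF le_b_idx[of x], of "real (n div ?q) powr p"] by simp
  then have "x / b n \<le> inverse (real (n div ?q) powr p)"
    using d pos[of n] assms by (simp add: field_simps)
  then have "(x / b n)\<^sup>2 \<le> (inverse (real (n div ?q) powr p))\<^sup>2"
    using assms pos[of n] by (intro power_mono) auto
  also have "\<dots> = real (n div ?q) powr (- 2 * p)"
    using d by (simp add: powr_minus[symmetric] power2_eq_square powr_add[symmetric])
  finally show ?thesis
    using False by (simp add: power_divide min.coboundedI2)
qed (simp add: add_increasing2)

text \<open>Indices below \<open>idx x\<close> contribute at most \<open>idx x\<close>. The others
  are grouped into blocks of length \<open>idx x\<close>, and the block sums form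
  \<open>idx x\<close> times a series that converges because 2p exceeds 1.\<close>

lemma sum_min_ratio_le:
  obtains D where "\<And>x N. 0 \<le> x \<Longrightarrow> (\<Sum>n=2..<N. min 1 (x\<^sup>2 / (b n)\<^sup>2)) \<le> D * real (idx x)"
proof -
  \<comment> \<open>The term at 0 is harmless since \<open>0 powr y = 0\<close>.\<close>
  define \<zeta> where "\<zeta> = (\<Sum>j. real j powr (- 2 * p))"
  have sm: "summable (\<lambda>j. real j powr (- 2 * p))"
    using p_gt by (subst summable_real_powr_iff) auto
  have "(\<Sum>n=2..<N. min 1 (x\<^sup>2 / (b n)\<^sup>2)) \<le> (1 + \<zeta>) * real (idx x)" if x: "0 \<le> x" for x N
  proof -
    let ?q = "idx x"
    let ?g = "\<lambda>n. (if n < ?q then 1 else 0 :: real) + real (n div ?q) powr (- 2 * p)"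
    have q: "0 < ?q"
      using idx_ge_2[of x] by simp
    have "(\<Sum>n=2..<N. min 1 (x\<^sup>2 / (b n)\<^sup>2)) \<le> (\<Sum>n=2..<N. ?g n)"
      using x by (intro sum_mono min_ratio_le) auto
    \<comment> \<open>Nonnegative terms are added up to a multiple of the block length, so that only
      complete blocks occur.\<close>
    also have "\<dots> \<le> (\<Sum>n<N * ?q. ?g n)"
    proof (intro sum_mono2)
      show "{2..<N} \<subseteq> {..<N * ?q}"
        using q by (auto intro: less_le_trans)
    qed auto
    also have "\<dots> = (\<Sum>n<N * ?q. if n < ?q then 1 else 0)
        + (\<Sum>n<N * ?q. real (n div ?q) powr (- 2 * p))"
      by (rule sum.distrib)
    also have "(\<Sum>n<N * ?q. if n < ?q then 1 else 0 :: real) \<le> real ?q"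
    proof -
      have "(\<Sum>n<N * ?q. if n < ?q then 1 else 0 :: real) = real (card ({..<N * ?q} \<inter> {..<?q}))"
        by (simp add: sum.If_cases lessThan_def)
      also have "\<dots> \<le> real (card {..<?q})"
        by (intro of_nat_mono card_mono) auto
      finally show ?thesis by simp
    qed
    also have "(\<Sum>n<N * ?q. real (n div ?q) powr (- 2 * p))
        = (\<Sum>j<N. \<Sum>n\<in>{j * ?q..<j * ?q + ?q}. real (n div ?q) powr (- 2 * p))"
      by (rule sum.nat_group[symmetric])
    also have "\<dots> = (\<Sum>j<N. real ?q * real j powr (- 2 * p))"
    proof (intro sum.cong refl)
      fix j
      have "n div ?q = j" if "n \<in> {j * ?q..<j * ?q + ?q}" for n
        using that by (intro div_nat_eqI) (auto simp: algebra_simps)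
      then show "(\<Sum>n\<in>{j * ?q..<j * ?q + ?q}. real (n div ?q) powr (- 2 * p))
          = real ?q * real j powr (- 2 * p)"
        by simp
    qed
    also have "\<dots> = real ?q * (\<Sum>j<N. real j powr (- 2 * p))"
      by (simp add: sum_distrib_left)
    also have "\<dots> \<le> real ?q * \<zeta>"
      unfolding \<zeta>_def by (intro mult_left_mono sum_le_suminf sm) auto
    finally show ?thesis
      by (simp add: algebra_simps)
  qed
  then show ?thesis by (rule that)
qed

end

section \<open>Borel--Cantelli arguments\<close>

context prob_space
begin

text \<open>If the series diverged, the product bound and \<open>1 - q \<le> exp (- q)\<close> would
  give probability 0 to having no exceedance from m on, for every m, so exceedances would occur
  infinitely often almost surely. Only exceedances in one direction are treated, since the product
  bound concerns events of the form \<open>X i \<le> c i\<close>.\<close>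

lemma neg_assoc_borel_cantelli:
  assumes X: "neg_assoc {1..} X" and meas: "\<And>i. i \<ge> 1 \<Longrightarrow> X i \<in> borel_measurable M"
    and ev: "AE \<omega> in M. \<forall>\<^sub>F n in sequentially. X n \<omega> \<le> c n"
  shows "summable (\<lambda>n. prob {\<omega> \<in> space M. c n < X n \<omega>})"
proof (rule ccontr)
  assume not_summable: "\<not> summable (\<lambda>n. prob {\<omega> \<in> space M. c n < X n \<omega>})"
  let ?q = "\<lambda>n. prob {\<omega> \<in> space M. c n < X n \<omega>}"
  let ?B = "\<lambda>m. {\<omega> \<in> space M. \<forall>n\<ge>m. X n \<omega> \<le> c n}"
  have null: "AE \<omega> in M. \<not> (\<forall>n\<ge>m. X n \<omega> \<le> c n)" if m: "m \<ge> 1" for m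
  proof -
    have [measurable]: "X n \<in> borel_measurable M" if "m \<le> n" for n
      using meas m that by simp
    have B: "?B m \<in> events"
      by measurable
    have le: "prob (?B m) \<le> exp (- (\<Sum>i=m..<N. ?q i))" for N
    proof -
      have "prob (?B m) \<le> prob {\<omega> \<in> space M. \<forall>i\<in>{m..<N}. X i \<omega> \<le> c i}"
      proof (rule finite_measure_mono)
        have "{\<omega> \<in> space M. X i \<omega> \<le> c i} \<in> events" if "i \<in> {m..<N}" for i
        proof -
          have [measurable]: "X i \<in> borel_measurable M"
            using meas m that by simp
          show ?thesis by measurable
        qed
        then show "{\<omega> \<in> space M. \<forall>i\<in>{m..<N}. X i \<omega> \<le> c i} \<in> events"
          by (intro sets.sets_Collect_finite_All finite_atLeastLessThan)
      qed auto
      also have "\<dots> \<le> (\<Prod>i=m..<N. prob {\<omega> \<in> space M. X i \<omega> \<le> c i})"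
        using m meas by (intro neg_assoc_prob_le_prod[OF X]) auto
      also have "\<dots> \<le> (\<Prod>i=m..<N. exp (- ?q i))"
      proof (intro prod_mono conjI measure_nonneg)
        fix i assume "i \<in> {m..<N}"
        then have [measurable]: "X i \<in> borel_measurable M"
          using meas m by simp
        have "{\<omega> \<in> space M. X i \<omega> \<le> c i} = space M - {\<omega> \<in> space M. c i < X i \<omega>}"
          by auto
        then have "prob {\<omega> \<in> space M. X i \<omega> \<le> c i} = 1 - ?q i"
          by (simp add: prob_compl)
        then show "prob {\<omega> \<in> space M. X i \<omega> \<le> c i} \<le> exp (- ?q i)"
          using exp_ge_add_one_self[of "- ?q i"] by simp
      qed
      also have "\<dots> = exp (- (\<Sum>i=m..<N. ?q i))"
        by (simp add: exp_sum sum_negf[symmetric])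
      finally show ?thesis .
    qed
    have "prob (?B m) = 0"
    proof (rule ccontr)
      assume "prob (?B m) \<noteq> 0"
      then have p: "prob (?B m) > 0"
        by (simp add: zero_less_measure_iff)
      \<comment> \<open>A positive probability would, after taking logarithms in \<open>le\<close>,
        bound all partial sums of the divergent series.\<close>
      have bound: "(\<Sum>i=m..<N. ?q i) \<le> - ln (prob (?B m))" for N
      proof -
        have "ln (prob (?B m)) \<le> ln (exp (- (\<Sum>i=m..<N. ?q i)))"
          using le[of N] p by (simp only: ln_le_cancel_iff exp_gt_zero)
        then show ?thesis
          by (simp only: ln_exp)
      qed
      have "summable (\<lambda>n. ?q (n + m))"
      proof (rule summableI_nonneg_bounded)
        fix N
        have "(\<Sum>n<N. ?q (n + m)) = (\<Sum>i=m..<N + m. ?q i)"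
          using sum.shift_bounds_nat_ivl[of ?q 0 m N] by (simp add: lessThan_atLeast0)
        then show "(\<Sum>n<N. ?q (n + m)) \<le> - ln (prob (?B m))"
          using bound by simp
      qed simp
      then show False
        using not_summable summable_iff_shift[of ?q m] by simp
    qed
    then have "?B m \<in> null_sets M"
      using B by (simp add: null_sets_def emeasure_eq_measure)
    then show ?thesis
      by (rule AE_I') auto
  qed
  have "AE \<omega> in M. \<forall>m\<in>{1..}. \<not> (\<forall>n\<ge>m. X n \<omega> \<le> c n)"
    by (rule AE_ball_countable') (use null in auto)
  with ev have "AE \<omega> in M. False"
  proof eventually_elim
    case (elim \<omega>)
    then obtain m where "\<forall>n\<ge>m. X n \<omega> \<le> c n"
      by (auto simp: eventually_at_top_linorder)
    then have "\<forall>n\<ge>max 1 m. X n \<omega> \<le> c n"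
      by simp
    then show ?case
      using bspec[OF elim(2), of "max 1 m"] by simp
  qed
  then show False by simp
qed

end

section \<open>Almost sure convergence along dyadic blocks\<close>

text \<open>The blocks tile the indices from 1 to \<open>2 ^ J - 1\<close>; the inequality only
  discards the term at 0.\<close>

lemma sum_powers_of_2_blocks:
  fixes u :: "nat \<Rightarrow> real"
  assumes "\<And>n. 0 \<le> u n"
  shows "(\<Sum>j<J. \<Sum>n=2 ^ j..<2 ^ Suc j. u n) \<le> (\<Sum>n<2 ^ J. u n)"
proof (induction J)
  case 0
  then show ?case using assms by simp
next
  case (Suc J)
  have "(\<Sum>n<2 ^ J. u n) + (\<Sum>n=2 ^ J..<2 ^ Suc J. u n) = (\<Sum>n<2 ^ Suc J. u n)"
    unfolding lessThan_atLeast0 by (rule sum.atLeastLessThan_concat) auto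
  then show ?case using Suc by simp
qed

locale prob_norming = prob_space M + norming b p \<beta> K
  for M :: "'a measure" and b :: "nat \<Rightarrow> real" and p \<beta> K :: real
begin

text \<open>The maximum and \<open>b\<close> both increase with n, so one event per dyadic block can
  be compared with all terms of the series in that block, whose weights 1 / n add up to at least
  1/2. The first Borel-Cantelli lemma handles these events, and growth of \<open>b\<close> by a
  bounded factor within a block fills in the other indices.\<close>

lemma summable_maximal_imp_AE_tendsto:
  assumes meas: "\<And>k. S k \<in> borel_measurable M"
    and sm: "\<And>\<epsilon>. \<epsilon> > 0 \<Longrightarrow> summable (\<lambda>n. 1 / real n *
      prob {\<omega> \<in> space M. \<exists>k\<in>{1..n}. \<bar>S k \<omega>\<bar> > \<epsilon> * b n})"
  shows "AE \<omega> in M. (\<lambda>n. (MAX k\<in>{1..n}. \<bar>S k \<omega>\<bar>) / b n) \<longlonglongrightarrow> 0"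
proof -
  note [measurable] = meas
  \<comment> \<open>The factor 4 K is the cost of replacing \<open>b (2 ^ (j + 2))\<close> by
    \<open>b n\<close> when n is at least \<open>2 ^ j\<close>.\<close>
  have ev: "AE \<omega> in M. \<forall>\<^sub>F n in sequentially. \<forall>k\<in>{1..n}. \<bar>S k \<omega>\<bar> \<le> 4 * K * \<epsilon> * b n"
    if \<epsilon>: "\<epsilon> > 0" for \<epsilon>
  proof -
    let ?u = "\<lambda>n. 1 / real n * prob {\<omega> \<in> space M. \<exists>k\<in>{1..n}. \<bar>S k \<omega>\<bar> > \<epsilon> * b n}"
    \<comment> \<open>The maximum stops at the beginning of the block while the threshold is taken
      at its end, so \<open>E j\<close> lies in the event of every n in the block.\<close>
    define E where "E j = {\<omega> \<in> space M. \<exists>k\<in>{1..2 ^ Suc j}. \<bar>S k \<omega>\<bar> > \<epsilon> * b (2 ^ Suc (Suc j))}" for j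
    have [measurable]: "E j \<in> events" for j
      unfolding E_def by measurable
    have block: "prob (E j) \<le> 2 * (\<Sum>n=2 ^ Suc j..<2 ^ Suc (Suc j). ?u n)" for j
    proof -
      \<comment> \<open>The block has \<open>2 ^ (j + 1)\<close> indices, each weighted by
        \<open>1 / 2 ^ (j + 2)\<close>.\<close>
      have "prob (E j) / 2 = (\<Sum>n\<in>{2 ^ Suc j..<2 ^ Suc (Suc j)::nat}. 1 / 2 ^ Suc (Suc j) * prob (E j))"
        by simp
      also have "\<dots> \<le> (\<Sum>n=2 ^ Suc j..<2 ^ Suc (Suc j). ?u n)"
      proof (intro sum_mono mult_mono)
        fix n :: nat assume n: "n \<in> {2 ^ Suc j..<2 ^ Suc (Suc j)}"
        have n2: "2 \<le> n"
          using n by (auto intro: order_trans[OF _ self_le_ge2_pow] order_trans[of _ "2 * 2 ^ j"])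
        have "real n \<le> real (2 ^ Suc (Suc j))"
          using n by (intro of_nat_mono) simp
        then show "1 / 2 ^ Suc (Suc j) \<le> 1 / real n"
          using n2 by (intro divide_left_mono) auto
        have "\<epsilon> * b n \<le> \<epsilon> * b (2 ^ Suc (Suc j))"
          using \<epsilon> n n2 by (intro mult_left_mono mono) auto
        then show "prob (E j) \<le> prob {\<omega> \<in> space M. \<exists>k\<in>{1..n}. \<bar>S k \<omega>\<bar> > \<epsilon> * b n}"
          unfolding E_def using n by (intro finite_measure_mono subsetI) (force, measurable)
      qed auto
      finally show ?thesis by simp
    qed
    have "summable (\<lambda>j. prob (E j))"
    proof (rule summableI_nonneg_bounded)
      fix J
      have "(\<Sum>j<J. prob (E j)) \<le> 2 * (\<Sum>j<J. \<Sum>n=2 ^ Suc j..<2 ^ Suc (Suc j). ?u n)"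
        by (subst sum_distrib_left) (intro sum_mono block)
      also have "(\<Sum>j<J. \<Sum>n=2 ^ Suc j..<2 ^ Suc (Suc j). ?u n)
          \<le> (\<Sum>j<Suc J. \<Sum>n=2 ^ j..<2 ^ Suc j. ?u n)"
        unfolding sum.lessThan_Suc_shift by (simp add: sum_nonneg)
      also have "\<dots> \<le> (\<Sum>n<2 ^ Suc J. ?u n)"
        by (rule sum_powers_of_2_blocks) simp
      also have "\<dots> \<le> suminf ?u"
        by (intro sum_le_suminf sm \<epsilon>) auto
      finally show "(\<Sum>j<J. prob (E j)) \<le> 2 * suminf ?u"
        by simp
    qed simp
    then have "AE \<omega> in M. \<forall>\<^sub>F j in sequentially. \<omega> \<in> space M - E j"
      by (intro borel_cantelli_AE1) (auto simp: emeasure_eq_measure)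
    then show ?thesis
    proof eventually_elim
      case (elim \<omega>)
      then obtain J where J: "\<And>j. j \<ge> J \<Longrightarrow> \<omega> \<in> space M - E j"
        by (auto simp: eventually_at_top_linorder)
      \<comment> \<open>The start \<open>2 ^ Suc J\<close> ensures both \<open>2 \<le> n\<close> and
        that the dyadic exponent j of n is at least J.\<close>
      show ?case
      proof (rule eventually_sequentiallyI[of "2 ^ Suc J"], rule ballI)
        fix n k :: nat assume n: "2 ^ Suc J \<le> n" and k: "k \<in> {1..n}"
        have n2: "2 \<le> n"
          using n by (rule order_trans[rotated]) simp
        obtain j where j: "2 ^ j \<le> n" "n < 2 ^ (j + 1)"
          using ex_power_ivl1[of 2 n] n2 by auto
        have "(2::nat) ^ Suc J < 2 ^ (j + 1)"
          using n j by linarith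
        then have "J \<le> j"
          using power_less_imp_less_exp[of "2::nat" "Suc J" "j + 1"] by simp
        then have "\<omega> \<in> space M - E j"
          by (rule J)
        moreover have "k \<in> {1..2 ^ Suc j}"
          using k j by simp
        ultimately have "\<bar>S k \<omega>\<bar> \<le> \<epsilon> * b (2 ^ Suc (Suc j))"
          unfolding E_def by force
        also have "b (2 ^ Suc (Suc j)) \<le> K * (real (2 ^ Suc (Suc j)) / real n) * b n"
          using n2 j by (intro upper_linear) auto
        also have "\<dots> \<le> K * 4 * b n"
        proof (intro mult_right_mono mult_left_mono)
          have "real (2 ^ j) \<le> real n"
            using j by (intro of_nat_mono)
          then show "real (2 ^ Suc (Suc j)) / real n \<le> 4"
            using n2 by (simp add: field_simps)
        qed (use K_ge_1 pos[OF n2] in auto)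
        finally show "\<bar>S k \<omega>\<bar> \<le> 4 * K * \<epsilon> * b n"
          using \<epsilon> by (simp add: algebra_simps)
      qed
    qed
  qed
  have "AE \<omega> in M. \<forall>m. \<forall>\<^sub>F n in sequentially. \<forall>k\<in>{1..n}. \<bar>S k \<omega>\<bar> \<le> 4 * K * (1 / real (Suc m)) * b n"
    unfolding AE_all_countable by (intro allI ev) simp
  then show ?thesis
  proof eventually_elim
    case (elim \<omega>)
    show ?case
    proof (rule LIMSEQ_I)
      fix r :: real assume "r > 0"
      then obtain m where m: "1 / real (Suc m) < r / (4 * K)"
        using nat_approx_posE[of "r / (4 * K)"] K_ge_1 by (auto simp: field_simps)
      have "\<forall>\<^sub>F n in sequentially. 2 \<le> n \<and> (\<forall>k\<in>{1..n}. \<bar>S k \<omega>\<bar> \<le> 4 * K * (1 / real (Suc m)) * b n)"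
        using elim by (intro eventually_conj eventually_ge_at_top) auto
      then obtain N where N: "\<And>n. n \<ge> N \<Longrightarrow> 2 \<le> n \<and> (\<forall>k\<in>{1..n}. \<bar>S k \<omega>\<bar> \<le> 4 * K * (1 / real (Suc m)) * b n)"
        unfolding eventually_at_top_linorder by blast
      show "\<exists>N. \<forall>n\<ge>N. norm ((MAX k\<in>{1..n}. \<bar>S k \<omega>\<bar>) / b n - 0) < r"
      proof (intro exI allI impI)
        fix n assume "N \<le> n"
        note n = N[OF this]
        have 1: "1 \<in> {1..n}"
          using n by simp
        have ge: "0 \<le> (MAX k\<in>{1..n}. \<bar>S k \<omega>\<bar>)"
          using 1 by (intro order_trans[OF abs_ge_zero Max_ge]) auto
        have "(MAX k\<in>{1..n}. \<bar>S k \<omega>\<bar>) \<le> 4 * K * (1 / real (Suc m)) * b n"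
          using n 1 by (intro Max.boundedI) auto
        also have "\<dots> < r * b n"
          using m K_ge_1 pos[of n] n by (intro mult_strict_right_mono) (auto simp: field_simps)
        finally show "norm ((MAX k\<in>{1..n}. \<bar>S k \<omega>\<bar>) / b n - 0) < r"
          using ge pos[of n] n by (simp add: field_simps)
      qed
    qed
  qed
qed

end

section \<open>Identically distributed negatively associated sequences\<close>

locale neg_assoc_identical = prob_norming M b p \<beta> K
  for M :: "'a measure" and b :: "nat \<Rightarrow> real" and p \<beta> K :: real +
  fixes X :: "nat \<Rightarrow> 'a \<Rightarrow> real" and X0 :: "'a \<Rightarrow> real"
  assumes neg_assoc: "neg_assoc {1..} X"
    and meas: "\<And>i. i \<ge> 1 \<Longrightarrow> X i \<in> borel_measurable M"
    and meas0 [measurable]: "X0 \<in> borel_measurable M"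
    and distr: "\<And>i. i \<ge> 1 \<Longrightarrow> distr M borel (X i) = distr M borel X0"
begin

lemma expectation_X:
  fixes h :: "real \<Rightarrow> real"
  assumes "i \<ge> 1" and [measurable]: "h \<in> borel_measurable borel"
  shows "expectation (\<lambda>\<omega>. h (X i \<omega>)) = expectation (\<lambda>\<omega>. h (X0 \<omega>))"
  using integral_distr[OF meas[OF assms(1)] assms(2)] integral_distr[OF meas0 assms(2)] distr[OF assms(1)]
  by simp

lemma prob_X:
  assumes "i \<ge> 1" "A \<in> sets borel"
  shows "prob {\<omega> \<in> space M. X i \<omega> \<in> A} = prob {\<omega> \<in> space M. X0 \<omega> \<in> A}"
  using measure_distr[OF meas[OF assms(1)] assms(2)] measure_distr[OF meas0 assms(2)] distr[OF assms(1)]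
  by (simp add: vimage_def Int_def conj_commute)

text \<open>Integrability of this variable is equivalent to summability of \<open>prob (\<bar>X0\<bar> > b n)\<close>.\<close>

abbreviation (input) Q :: "'a \<Rightarrow> real" where
  "Q \<equiv> \<lambda>\<omega>. real (idx \<bar>X0 \<omega>\<bar>)"

lemma integrable_X0: "integrable M Q \<Longrightarrow> integrable M X0"
  by (rule Bochner_Integration.integrable_bound[of M "\<lambda>\<omega>. K * b 2 * Q \<omega>"])
    (use K_ge_1 pos_2 le_idx in \<open>auto simp: abs_mult\<close>)

section \<open>Truncated moments of the common distribution\<close>

text \<open>For n from 2 on, this is the second moment of X0 clipped at \<open>b n\<close>, divided
  by \<open>(b n)\<^sup>2\<close>. It also dominates the probability that the absolute value of X0
  exceeds \<open>b n\<close>, so it controls both contributions to the n-th term.\<close>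

abbreviation (input) D :: "nat \<Rightarrow> real" where
  "D n \<equiv> expectation (\<lambda>\<omega>. min 1 ((X0 \<omega>)\<^sup>2 / (b n)\<^sup>2))"

lemma integrable_min_ratio: "integrable M (\<lambda>\<omega>. min 1 ((X0 \<omega>)\<^sup>2 / (b n)\<^sup>2))"
  by (rule integrable_const_bound[where B = 1]) auto

text \<open>The pathwise bound on the sum over n is integrated against the distribution of X0. The
  shift by 2 skips the indices at which the growth conditions say nothing about
  \<open>b\<close>.\<close>

lemma summable_D:
  assumes Q: "integrable M Q"
  shows "summable D"
proof -
  obtain c where c: "\<And>x N. 0 \<le> x \<Longrightarrow> (\<Sum>n=2..<N. min 1 (x\<^sup>2 / (b n)\<^sup>2)) \<le> c * real (idx x)"
    using sum_min_ratio_le by blast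
  have "summable (\<lambda>n. D (n + 2))"
  proof (rule summableI_nonneg_bounded)
    show "0 \<le> D (n + 2)" for n
      by (intro Bochner_Integration.integral_nonneg) simp
    fix N
    have "(\<Sum>n<N. D (n + 2)) = (\<Sum>n=2..<N + 2. D n)"
      using sum.shift_bounds_nat_ivl[of D 0 2 N] by (simp only: lessThan_atLeast0 add_0)
    also have "\<dots> = expectation (\<lambda>\<omega>. \<Sum>n=2..<N + 2. min 1 (\<bar>X0 \<omega>\<bar>\<^sup>2 / (b n)\<^sup>2))"
      using integrable_min_ratio by (simp add: Bochner_Integration.integral_sum)
    also have "\<dots> \<le> expectation (\<lambda>\<omega>. c * Q \<omega>)"
      using Q integrable_min_ratio
      by (intro integral_mono c Bochner_Integration.integrable_sum) auto
    finally show "(\<Sum>n<N. D (n + 2)) \<le> expectation (\<lambda>\<omega>. c * Q \<omega>)" .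
  qed
  then show ?thesis
    by (simp only: summable_iff_shift[of D])
qed

text \<open>Dominated convergence with majorant \<open>K * Q\<close>: for fixed \<omega> the
  integrand is 0 once n reaches \<open>idx \<bar>X0 \<omega>\<bar>\<close>. The limit shows that the
  change of mean caused by clipping, accumulated over n summands, is negligible against
  \<open>b n\<close>.\<close>

lemma excess_tendsto_0:
  assumes Q: "integrable M Q"
  shows "(\<lambda>n. real n / b n * expectation (\<lambda>\<omega>. max 0 (\<bar>X0 \<omega>\<bar> - b n))) \<longlonglongrightarrow> 0"
proof (rule LIMSEQ_offset[where k = 2])
  let ?s = "\<lambda>n \<omega>. real (n + 2) / b (n + 2) * max 0 (\<bar>X0 \<omega>\<bar> - b (n + 2))"
  have bound: "0 \<le> ?s n \<omega> \<and> ?s n \<omega> \<le> (if n + 2 < idx \<bar>X0 \<omega>\<bar> then K * Q \<omega> else 0)" for n \<omega>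
    using excess_bound[of "n + 2" "\<bar>X0 \<omega>\<bar>"] pos[of "n + 2"] by auto
  have "(\<lambda>n. expectation (?s n)) \<longlonglongrightarrow> expectation (\<lambda>\<omega>. 0)"
  proof (rule integral_dominated_convergence[where w = "\<lambda>\<omega>. K * Q \<omega>"])
    show "integrable M (\<lambda>\<omega>. K * Q \<omega>)"
      using Q by simp
    show "AE \<omega> in M. norm (?s n \<omega>) \<le> K * Q \<omega>" for n
    proof (rule AE_I2)
      fix \<omega>
      have "(if n + 2 < idx \<bar>X0 \<omega>\<bar> then K * Q \<omega> else 0) \<le> K * Q \<omega>"
        using K_ge_1 by simp
      then show "norm (?s n \<omega>) \<le> K * Q \<omega>"
        unfolding real_norm_def abs_of_nonneg[OF conjunct1[OF bound[of n \<omega>]]]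
        using bound[of n \<omega>] by linarith
    qed
    show "AE \<omega> in M. (\<lambda>n. ?s n \<omega>) \<longlonglongrightarrow> 0"
    proof (rule AE_I2, rule tendsto_eventually, rule eventually_sequentiallyI)
      fix \<omega> n assume "idx \<bar>X0 \<omega>\<bar> \<le> n"
      then show "?s n \<omega> = 0"
        using bound[of n \<omega>] by auto
    qed
  qed measurable
  then show "(\<lambda>n. real (n + 2) / b (n + 2) * expectation (\<lambda>\<omega>. max 0 (\<bar>X0 \<omega>\<bar> - b (n + 2)))) \<longlonglongrightarrow> 0"
    by simp
qed

section \<open>Convergence of the weighted series\<close>

text \<open>Unless some \<open>X i\<close> exceeds \<open>b n\<close> in absolute value, the centred
  sum equals a weighted sum of centred clipped variables plus a deterministic drift. The drift takes
  half of the level by \<open>small\<close>, the maximal inequality treats the other half, and a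
  union bound treats the large values. Clipping at a level independent of the weights leaves only
  the sum of their squares to control.\<close>

lemma prob_weighted_sums_le:
  assumes Q: "integrable M Q" and n: "2 \<le> n" and \<epsilon>: "\<epsilon> > 0"
    and a: "(\<Sum>i=1..n. (a i)\<^sup>2) \<le> C * real n"
    and small: "2 * sqrt C * (real n / b n * expectation (\<lambda>\<omega>. max 0 (\<bar>X0 \<omega>\<bar> - b n))) \<le> \<epsilon>"
  shows "prob {\<omega> \<in> space M. \<exists>k\<in>{1..n}. \<bar>\<Sum>i=1..k. a i * (X i \<omega> - expectation X0)\<bar> > \<epsilon> * b n}
    \<le> real n * ((1 + 32 * C / \<epsilon>\<^sup>2) * D n)"
proof -
  define B where "B = b n"
  have B: "B > 0"
    unfolding B_def by (rule pos[OF n])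
  \<comment> \<open>Clipping is nondecreasing and so preserves negative association; setting large
    values to 0 would not be monotone.\<close>
  define clip where "clip x = max (- B) (min B x)" for x :: real
  have [measurable]: "clip \<in> borel_measurable borel"
    unfolding clip_def[abs_def] by measurable
  define \<nu> where "\<nu> = expectation (\<lambda>\<omega>. clip (X0 \<omega>))"
  define Z where "Z i \<omega> = clip (X i \<omega>) - \<nu>" for i \<omega>
  have clip_le: "\<bar>clip x\<bar> \<le> B" for x
    using B by (auto simp: clip_def)
  have clip_sq: "(clip x)\<^sup>2 = B\<^sup>2 * min 1 (x\<^sup>2 / B\<^sup>2)" for x
  proof (cases "\<bar>x\<bar> \<le> B")
    case True
    then have "x\<^sup>2 \<le> B\<^sup>2"
      using abs_le_square_iff[of x B] B by simp
    moreover have "clip x = x"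
      using True by (auto simp: clip_def)
    ultimately show ?thesis
      using B by simp
  next
    case False
    then have "B\<^sup>2 \<le> x\<^sup>2"
      using abs_le_square_iff[of B x] B by simp
    moreover have "(clip x)\<^sup>2 = B\<^sup>2"
    proof -
      have "clip x = B \<or> clip x = - B"
        using False B by (auto simp: clip_def)
      then show ?thesis by auto
    qed
    ultimately show ?thesis
      using B by simp
  qed
  have Zm: "Z i \<in> borel_measurable M" if "i \<ge> 1" for i
    unfolding Z_def using meas[OF that] by measurable
  have int_clip: "integrable M (\<lambda>\<omega>. clip (V \<omega>))" if [measurable]: "V \<in> borel_measurable M" for V
    using clip_le by (intro integrable_const_bound[where B = B]) auto
  have int_clip_sq: "integrable M (\<lambda>\<omega>. (clip (V \<omega>))\<^sup>2)" if [measurable]: "V \<in> borel_measurable M" for V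
    unfolding clip_sq
    by (intro integrable_mult_right integrable_const_bound[where B = 1]) auto
  have NA: "neg_assoc {1..} Z"
    unfolding Z_def[abs_def]
    by (rule neg_assoc_comp_mono[OF neg_assoc, of "\<lambda>i x. clip x - \<nu>"]) (auto simp: mono_def clip_def)
  have mean: "expectation (Z i) = 0" if "i \<ge> 1" for i
    using int_clip[OF meas[OF that]] expectation_X[OF that, of clip]
    by (simp add: Z_def[abs_def] \<nu>_def prob_space)
  have Z_sq: "(Z i \<omega>)\<^sup>2 = (clip (X i \<omega>))\<^sup>2 - 2 * \<nu> * clip (X i \<omega>) + \<nu>\<^sup>2" for i \<omega>
    by (simp add: Z_def power2_diff)
  have int_Z_sq: "integrable M (\<lambda>\<omega>. (Z i \<omega>)\<^sup>2)" if "i \<ge> 1" for i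
    unfolding Z_sq using int_clip[OF meas[OF that]] int_clip_sq[OF meas[OF that]] by simp
  have var: "expectation (\<lambda>\<omega>. (Z i \<omega>)\<^sup>2) \<le> B\<^sup>2 * D n" if "i \<ge> 1" for i
  proof -
    have "expectation (\<lambda>\<omega>. (Z i \<omega>)\<^sup>2) = expectation (\<lambda>\<omega>. (clip (X i \<omega>))\<^sup>2) - \<nu>\<^sup>2"
      unfolding Z_sq using int_clip[OF meas[OF that]] int_clip_sq[OF meas[OF that]] expectation_X[OF that, of clip]
      by (simp add: \<nu>_def[symmetric] prob_space power2_eq_square)
    also have "\<dots> \<le> expectation (\<lambda>\<omega>. (clip (X i \<omega>))\<^sup>2)"
      by simp
    also have "\<dots> = expectation (\<lambda>\<omega>. (clip (X0 \<omega>))\<^sup>2)"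
      using expectation_X[OF that, of "\<lambda>x. (clip x)\<^sup>2"] by simp
    also have "\<dots> = B\<^sup>2 * D n"
      unfolding clip_sq B_def by simp
    finally show ?thesis .
  qed
  let ?\<mu> = "expectation X0"
  have \<nu>_\<mu>: "\<bar>\<nu> - ?\<mu>\<bar> \<le> expectation (\<lambda>\<omega>. max 0 (\<bar>X0 \<omega>\<bar> - B))"
  proof -
    have "\<bar>\<nu> - ?\<mu>\<bar> = \<bar>expectation (\<lambda>\<omega>. clip (X0 \<omega>) - X0 \<omega>)\<bar>"
      using int_clip[OF meas0] integrable_X0[OF Q] by (simp add: \<nu>_def)
    also have "\<dots> \<le> expectation (\<lambda>\<omega>. \<bar>clip (X0 \<omega>) - X0 \<omega>\<bar>)"
      by (rule integral_abs_bound)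
    also have "(\<lambda>\<omega>. \<bar>clip (X0 \<omega>) - X0 \<omega>\<bar>) = (\<lambda>\<omega>. max 0 (\<bar>X0 \<omega>\<bar> - B))"
      using B by (auto simp: clip_def fun_eq_iff)
    finally show ?thesis .
  qed
  \<comment> \<open>Nonnegativity of C, needed for \<open>sqrt C\<close>, comes from the nonnegative
    sum of squares and positive n.\<close>
  have C: "0 \<le> C"
  proof -
    have "0 \<le> C * real n"
      using a by (rule order_trans[rotated]) (simp add: sum_nonneg)
    then show ?thesis
      using n by (simp add: zero_le_mult_iff)
  qed
  have weights: "(\<Sum>i=1..n. \<bar>a i\<bar>) \<le> sqrt C * real n"
  proof (rule power2_le_imp_le)
    have "(\<Sum>i=1..n. \<bar>a i\<bar>)\<^sup>2 \<le> (\<Sum>i=1..n. \<bar>a i\<bar>\<^sup>2) * (\<Sum>i=1..n. 1\<^sup>2)"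
      using Cauchy_Schwarz_ineq_sum[of "\<lambda>i. \<bar>a i\<bar>" "\<lambda>_. 1" "{1..n}"] by simp
    also have "\<dots> \<le> C * real n * real n"
      using a by (simp add: mult_right_mono)
    also have "\<dots> = (sqrt C * real n)\<^sup>2"
      using C by (simp add: power_mult_distrib power2_eq_square[of "real n"])
    finally show "(\<Sum>i=1..n. \<bar>a i\<bar>)\<^sup>2 \<le> (sqrt C * real n)\<^sup>2" .
  qed (use C in simp)
  \<comment> \<open>The sum of absolute weights is at most \<open>sqrt C * n\<close> by
    Cauchy-Schwarz, which accounts for the factor \<open>2 * sqrt C\<close> in
    \<open>small\<close>.\<close>
  have drift: "(\<Sum>i=1..n. \<bar>a i\<bar>) * \<bar>\<nu> - ?\<mu>\<bar> \<le> \<epsilon> * B / 2"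
  proof -
    have "(\<Sum>i=1..n. \<bar>a i\<bar>) * \<bar>\<nu> - ?\<mu>\<bar> \<le> sqrt C * real n * expectation (\<lambda>\<omega>. max 0 (\<bar>X0 \<omega>\<bar> - B))"
      using weights \<nu>_\<mu> C by (intro mult_mono) auto
    also have "\<dots> \<le> \<epsilon> * B / 2"
      using small B by (simp add: B_def[symmetric] field_simps)
    finally show ?thesis .
  qed
  let ?A = "{\<omega> \<in> space M. \<exists>k\<in>{1..n}. \<bar>\<Sum>i=1..k. a i * (X i \<omega> - ?\<mu>)\<bar> > \<epsilon> * b n}"
  let ?T = "\<lambda>i. {\<omega> \<in> space M. X i \<omega> \<in> {x. B < \<bar>x\<bar>}}"
  let ?R = "{\<omega> \<in> space M. \<exists>k\<in>{1..n}. \<bar>\<Sum>i=1..k. a i * Z i \<omega>\<bar> > \<epsilon> * B / 2}"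
  have T: "?T i \<in> events" if "i \<in> {1..n}" for i
  proof -
    have [measurable]: "X i \<in> borel_measurable M"
      using meas that by simp
    show ?thesis by measurable
  qed
  have "(\<lambda>\<omega>. \<Sum>i=1..k. a i * Z i \<omega>) \<in> borel_measurable M" for k
    using Zm by (intro borel_measurable_sum borel_measurable_times) auto
  note [measurable] = this
  have R: "?R \<in> events"
    by measurable
  have "?A \<subseteq> (\<Union>i\<in>{1..n}. ?T i) \<union> ?R"
  proof (rule subsetI, rule ccontr)
    fix \<omega> assume \<omega>: "\<omega> \<in> ?A" and not: "\<omega> \<notin> (\<Union>i\<in>{1..n}. ?T i) \<union> ?R"
    obtain k where k: "k \<in> {1..n}" and gt: "\<epsilon> * B < \<bar>\<Sum>i=1..k. a i * (X i \<omega> - ?\<mu>)\<bar>"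
      using \<omega> by (auto simp: B_def)
    have X: "clip (X i \<omega>) = X i \<omega>" if "i \<in> {1..n}" for i
    proof -
      have "\<bar>X i \<omega>\<bar> \<le> B"
        using not \<omega> that by (auto simp: not_less)
      then show ?thesis by (auto simp: clip_def)
    qed
    have "(\<Sum>i=1..k. a i * (X i \<omega> - ?\<mu>)) = (\<Sum>i=1..k. a i * Z i \<omega> + a i * (\<nu> - ?\<mu>))"
    proof (intro sum.cong refl)
      fix i assume "i \<in> {1..k}"
      then show "a i * (X i \<omega> - ?\<mu>) = a i * Z i \<omega> + a i * (\<nu> - ?\<mu>)"
        using X[of i] k by (simp add: Z_def algebra_simps)
    qed
    also have "\<bar>\<dots>\<bar> \<le> \<bar>\<Sum>i=1..k. a i * Z i \<omega>\<bar> + \<bar>\<Sum>i=1..k. a i * (\<nu> - ?\<mu>)\<bar>"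
      unfolding sum.distrib by (rule abs_triangle_ineq)
    also have "\<bar>\<Sum>i=1..k. a i * (\<nu> - ?\<mu>)\<bar> \<le> \<epsilon> * B / 2"
    proof -
      have "\<bar>\<Sum>i=1..k. a i * (\<nu> - ?\<mu>)\<bar> = \<bar>\<Sum>i=1..k. a i\<bar> * \<bar>\<nu> - ?\<mu>\<bar>"
        by (simp add: sum_distrib_right[symmetric] abs_mult)
      also have "\<dots> \<le> (\<Sum>i=1..n. \<bar>a i\<bar>) * \<bar>\<nu> - ?\<mu>\<bar>"
      proof (rule mult_right_mono)
        have "\<bar>\<Sum>i=1..k. a i\<bar> \<le> (\<Sum>i=1..k. \<bar>a i\<bar>)"
          by (rule sum_abs)
        also have "\<dots> \<le> (\<Sum>i=1..n. \<bar>a i\<bar>)"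
          using k by (intro sum_mono2) auto
        finally show "\<bar>\<Sum>i=1..k. a i\<bar> \<le> (\<Sum>i=1..n. \<bar>a i\<bar>)" .
      qed simp
      also note drift
      finally show ?thesis .
    qed
    also have "\<bar>\<Sum>i=1..k. a i * Z i \<omega>\<bar> \<le> \<epsilon> * B / 2"
      using not \<omega> k by (auto simp: not_less)
    finally show False
      using gt by linarith
  qed
  then have "prob ?A \<le> prob ((\<Union>i\<in>{1..n}. ?T i) \<union> ?R)"
    by (rule finite_measure_mono) (intro sets.Un sets.finite_UN T R finite_atLeastAtMost)
  also have "\<dots> \<le> prob (\<Union>i\<in>{1..n}. ?T i) + prob ?R"
    by (intro measure_Un_le sets.finite_UN T R finite_atLeastAtMost)
  also have "prob (\<Union>i\<in>{1..n}. ?T i) \<le> (\<Sum>i=1..n. prob (?T i))"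
    by (intro measure_UNION_le T finite_atLeastAtMost)
  \<comment> \<open>Where the absolute value of X0 exceeds B, the minimum in \<open>D n\<close>
    equals 1.\<close>
  also have "(\<Sum>i=1..n. prob (?T i)) \<le> (\<Sum>i=1..n. D n)"
  proof (rule sum_mono)
    fix i assume "i \<in> {1..n}"
    then have "prob (?T i) = prob {\<omega> \<in> space M. X0 \<omega> \<in> {x. B < \<bar>x\<bar>}}"
      by (intro prob_X) auto
    also have "\<dots> = expectation (indicator {\<omega> \<in> space M. B < \<bar>X0 \<omega>\<bar>})"
      by (auto intro!: arg_cong[where f = prob])
    also have "\<dots> \<le> D n"
    proof (rule integral_mono[OF _ integrable_min_ratio])
      show "integrable M (indicat_real {\<omega> \<in> space M. B < \<bar>X0 \<omega>\<bar>})"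
        by (intro integrable_real_indicator) (auto simp: emeasure_eq_measure)
      fix \<omega>
      show "indicat_real {\<omega> \<in> space M. B < \<bar>X0 \<omega>\<bar>} \<omega> \<le> min 1 ((X0 \<omega>)\<^sup>2 / (b n)\<^sup>2)"
      proof (cases "B < \<bar>X0 \<omega>\<bar>")
        case True
        then have "B\<^sup>2 \<le> (X0 \<omega>)\<^sup>2"
          using abs_le_square_iff[of B "X0 \<omega>"] B by simp
        then show ?thesis
          using B by (simp add: B_def indicator_def)
      qed (simp add: indicator_def)
    qed
    finally show "prob (?T i) \<le> D n" .
  qed
  also have "prob ?R \<le> 8 / (\<epsilon> * B / 2)\<^sup>2 * (\<Sum>i=1..n. (a i)\<^sup>2 * expectation (\<lambda>\<omega>. (Z i \<omega>)\<^sup>2))"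
    using \<epsilon> B by (intro neg_assoc_weighted_maximal_inequality NA Zm int_Z_sq mean) auto
  also have "\<dots> \<le> 8 / (\<epsilon> * B / 2)\<^sup>2 * (\<Sum>i=1..n. (a i)\<^sup>2 * (B\<^sup>2 * D n))"
    by (intro mult_left_mono sum_mono var) auto
  also have "\<dots> = 8 / (\<epsilon> * B / 2)\<^sup>2 * (B\<^sup>2 * D n) * (\<Sum>i=1..n. (a i)\<^sup>2)"
    by (simp add: sum_distrib_right[symmetric] mult.commute)
  also have "\<dots> \<le> 8 / (\<epsilon> * B / 2)\<^sup>2 * (B\<^sup>2 * D n) * (C * real n)"
    by (intro mult_left_mono a mult_nonneg_nonneg Bochner_Integration.integral_nonneg) auto
  \<comment> \<open>The level \<open>\<epsilon> * B / 2\<close> turns 8 into 32, and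
    \<open>B\<^sup>2\<close> cancels against the variance bound.\<close>
  also have "\<dots> = 32 * C / \<epsilon>\<^sup>2 * D n * real n"
    using B by (simp add: power_mult_distrib power_divide)
  finally show ?thesis
    by (simp add: algebra_simps)
qed

text \<open>The weights enter the drift only through C, so one threshold for n serves all rows.
  Dividing by n cancels the number of summands and leaves a multiple of the summable
  \<open>D n\<close>. Centring at the mean lets the result be used before the mean is known to be
  0.\<close>

lemma summable_weighted_sums:
  assumes Q: "integrable M Q" and \<epsilon>: "\<epsilon> > 0"
    and a: "\<And>n. n \<ge> 1 \<Longrightarrow> (\<Sum>i=1..n. (a n i)\<^sup>2) \<le> C * real n"
  shows "summable (\<lambda>n. 1 / real n * prob {\<omega> \<in> space M.
    \<exists>k\<in>{1..n}. \<bar>\<Sum>i=1..k. a n i * (X i \<omega> - expectation X0)\<bar> > \<epsilon> * b n})"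
proof (rule summable_comparison_test_ev)
  show "summable (\<lambda>n. (1 + 32 * C / \<epsilon>\<^sup>2) * D n)"
    by (intro summable_mult summable_D Q)
  have "(\<lambda>n. 2 * sqrt C * (real n / b n * expectation (\<lambda>\<omega>. max 0 (\<bar>X0 \<omega>\<bar> - b n)))) \<longlonglongrightarrow> 0"
    by (rule tendsto_mult_right_zero[OF excess_tendsto_0[OF Q]])
  then have "\<forall>\<^sub>F n in sequentially. 2 * sqrt C * (real n / b n * expectation (\<lambda>\<omega>. max 0 (\<bar>X0 \<omega>\<bar> - b n))) < \<epsilon>"
    using \<epsilon> by (rule order_tendstoD)
  with eventually_ge_at_top[of 2]
  show "\<forall>\<^sub>F n in sequentially. norm (1 / real n * prob {\<omega> \<in> space M.
    \<exists>k\<in>{1..n}. \<bar>\<Sum>i=1..k. a n i * (X i \<omega> - expectation X0)\<bar> > \<epsilon> * b n}) \<le> (1 + 32 * C / \<epsilon>\<^sup>2) * D n"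
  proof eventually_elim
    case (elim n)
    have "prob {\<omega> \<in> space M. \<exists>k\<in>{1..n}. \<bar>\<Sum>i=1..k. a n i * (X i \<omega> - expectation X0)\<bar> > \<epsilon> * b n}
      \<le> real n * ((1 + 32 * C / \<epsilon>\<^sup>2) * D n)"
      using elim a[of n] by (intro prob_weighted_sums_le Q \<epsilon>) auto
    then show ?case
      using elim by (simp add: divide_le_eq mult.commute)
  qed
qed

lemma sums_measurable: "(\<lambda>\<omega>. \<Sum>i=1..k. X i \<omega> - c) \<in> borel_measurable M"
  using meas by (intro borel_measurable_sum borel_measurable_diff) auto

section \<open>The strong law and its converse\<close>

text \<open>Constant weights 1 satisfy the row condition with C = 1, and the dyadic argument turns
  the resulting series into almost sure convergence.\<close>

lemma strong_law:
  assumes "integrable M Q"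
  shows "AE \<omega> in M. (\<lambda>n. (MAX k\<in>{1..n}. \<bar>\<Sum>i=1..k. X i \<omega> - expectation X0\<bar>) / b n) \<longlonglongrightarrow> 0"
  using summable_weighted_sums[OF assms, of _ "\<lambda>_ _. 1" 1]
  by (intro summable_maximal_imp_AE_tendsto sums_measurable) simp

text \<open>The available Borel-Cantelli lemma is one-sided, so it is applied to X and to -X. Adding
  the two series bounds the tail probabilities of \<open>idx \<bar>X0\<bar>\<close>.\<close>

lemma integrable_Q_if_eventually_le:
  assumes "AE \<omega> in M. \<forall>\<^sub>F n in sequentially. \<bar>X n \<omega>\<bar> \<le> b n"
  shows "integrable M Q"
proof -
  have 1: "summable (\<lambda>n. prob {\<omega> \<in> space M. b n < X n \<omega>})"
  proof (intro neg_assoc_borel_cantelli neg_assoc meas)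
    show "AE \<omega> in M. \<forall>\<^sub>F n in sequentially. X n \<omega> \<le> b n"
      using assms by eventually_elim (erule eventually_mono, linarith)
  qed
  have 2: "summable (\<lambda>n. prob {\<omega> \<in> space M. b n < - X n \<omega>})"
  proof (intro neg_assoc_borel_cantelli neg_assoc_uminus neg_assoc borel_measurable_uminus meas)
    show "AE \<omega> in M. \<forall>\<^sub>F n in sequentially. - X n \<omega> \<le> b n"
      using assms by eventually_elim (erule eventually_mono, linarith)
  qed
  have le: "prob {\<omega> \<in> space M. n < idx \<bar>X0 \<omega>\<bar>}
      \<le> prob {\<omega> \<in> space M. b n < X n \<omega>} + prob {\<omega> \<in> space M. b n < - X n \<omega>}" if n: "2 \<le> n" for n
  proof -
    have [measurable]: "X n \<in> borel_measurable M"
      using meas n by simp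
    have "prob {\<omega> \<in> space M. n < idx \<bar>X0 \<omega>\<bar>} = prob {\<omega> \<in> space M. X0 \<omega> \<in> {x. b n < \<bar>x\<bar>}}"
      using less_idx_iff[OF n] by simp
    also have "\<dots> = prob {\<omega> \<in> space M. X n \<omega> \<in> {x. b n < \<bar>x\<bar>}}"
      using n by (intro prob_X[symmetric]) auto
    also have "{\<omega> \<in> space M. X n \<omega> \<in> {x. b n < \<bar>x\<bar>}}
        = {\<omega> \<in> space M. b n < X n \<omega>} \<union> {\<omega> \<in> space M. b n < - X n \<omega>}"
      by auto
    also have "prob \<dots> \<le> prob {\<omega> \<in> space M. b n < X n \<omega>} + prob {\<omega> \<in> space M. b n < - X n \<omega>}"
      by (intro measure_Un_le) measurable
    finally show ?thesis .
  qed
  have sm: "summable (\<lambda>n. prob {\<omega> \<in> space M. n < idx \<bar>X0 \<omega>\<bar>})"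
  proof (rule summable_comparison_test'[OF summable_add[OF 1 2], of 2])
    fix n :: nat assume "2 \<le> n"
    then show "norm (prob {\<omega> \<in> space M. n < idx \<bar>X0 \<omega>\<bar>})
      \<le> prob {\<omega> \<in> space M. b n < X n \<omega>} + prob {\<omega> \<in> space M. b n < - X n \<omega>}"
      unfolding real_norm_def abs_of_nonneg[OF measure_nonneg] by (rule le)
  qed
  \<comment> \<open>The expectation of a natural-valued variable is the sum of its tail
    probabilities.\<close>
  have "(\<integral>\<^sup>+\<omega>. of_nat (idx \<bar>X0 \<omega>\<bar>) \<partial>M) = (\<Sum>n. emeasure M {\<omega> \<in> space M. n < idx \<bar>X0 \<omega>\<bar>})"
    by (rule nn_integral_nat_function) measurable
  also have "\<dots> < \<infinity>"
    unfolding emeasure_eq_measure infinity_ennreal_def less_top[symmetric]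
    by (rule ennreal_suminf_neq_top[OF sm measure_nonneg])
  finally have "(\<integral>\<^sup>+\<omega>. ennreal (Q \<omega>) \<partial>M) < \<infinity>"
    unfolding ennreal_of_nat_eq_real_of_nat .
  then show ?thesis
    by (rule integrableI_nonneg[rotated 2]) simp_all
qed

text \<open>Each X n is a difference of consecutive partial sums, hence eventually at most
  \<open>b n\<close> in absolute value, and \<open>Q\<close> is integrable. The strong law then
  applies to the centred variables; comparing it with the assumed limit for the uncentred sums
  contradicts divergence of \<open>n / b n\<close> unless the mean is 0.\<close>

lemma strong_law_converse:
  assumes lim: "AE \<omega> in M. (\<lambda>n. (MAX k\<in>{1..n}. \<bar>\<Sum>i=1..k. X i \<omega>\<bar>) / b n) \<longlonglongrightarrow> 0"
  shows "integrable M Q" and "expectation X0 = 0"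
proof -
  have Max_ge: "\<bar>S k\<bar> \<le> (MAX k\<in>{1..n}. \<bar>S k\<bar>)" if "k \<in> {1..n}" for S :: "nat \<Rightarrow> real" and k n
    using that by (intro Max_ge) auto
  have "AE \<omega> in M. \<forall>\<^sub>F n in sequentially. \<bar>X n \<omega>\<bar> \<le> b n"
    using lim
  proof eventually_elim
    case (elim \<omega>)
    have "\<forall>\<^sub>F n in sequentially. (MAX k\<in>{1..n}. \<bar>\<Sum>i=1..k. X i \<omega>\<bar>) / b n < 1 / 2"
      using elim by (rule order_tendstoD) simp
    with eventually_ge_at_top[of 2] show ?case
    proof eventually_elim
      case (elim n)
      let ?S = "\<lambda>k. \<Sum>i=1..k. X i \<omega>"
      \<comment> \<open>With half of \<open>b n\<close> for each, the partial sums at n and n - 1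
        leave at most \<open>b n\<close> for \<open>X n\<close>; \<open>2 \<le> n\<close> keeps n -
        1 in the range of the maximum.\<close>
      have le: "(MAX k\<in>{1..n}. \<bar>?S k\<bar>) \<le> b n / 2"
        using elim pos[of n] by (simp add: field_simps)
      have "\<bar>?S n\<bar> \<le> b n / 2"
        by (rule order_trans[OF Max_ge le]) (use elim in simp)
      moreover have "\<bar>?S (n - 1)\<bar> \<le> b n / 2"
        by (rule order_trans[OF Max_ge le]) (use elim in simp)
      moreover have "?S n = ?S (n - 1) + X n \<omega>"
        using elim by (cases n) simp_all
      ultimately show ?case by linarith
    qed
  qed
  then show Q: "integrable M Q"
    by (rule integrable_Q_if_eventually_le)
  let ?\<mu> = "expectation X0"
  \<comment> \<open>The claim is free of \<omega>; the almost sure form allows both limits to be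
    used at a common point.\<close>
  have "AE \<omega> in M. ?\<mu> = 0"
    using lim strong_law[OF Q]
  proof eventually_elim
    case (elim \<omega>)
    let ?S = "\<lambda>k. \<Sum>i=1..k. X i \<omega>" and ?S' = "\<lambda>k. \<Sum>i=1..k. X i \<omega> - ?\<mu>"
    have lim0: "(\<lambda>n. (MAX k\<in>{1..n}. \<bar>?S k\<bar>) / b n + (MAX k\<in>{1..n}. \<bar>?S' k\<bar>) / b n) \<longlonglongrightarrow> 0"
      using tendsto_add[OF elim] by simp
    show "?\<mu> = 0"
    proof (rule ccontr)
      assume \<mu>: "?\<mu> \<noteq> 0"
      have "\<forall>\<^sub>F n in sequentially. 1 \<le> \<bar>?\<mu>\<bar> * (real n / b n)"
      proof -
        have "filterlim (\<lambda>n. \<bar>?\<mu>\<bar> * (real n / b n)) at_top sequentially"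
          using \<mu> by (intro filterlim_tendsto_pos_mult_at_top[OF tendsto_const _ tendsto_ratio_at_top]) simp
        then show ?thesis
          by (simp add: filterlim_at_top)
      qed
      moreover have "\<forall>\<^sub>F n in sequentially.
          (MAX k\<in>{1..n}. \<bar>?S k\<bar>) / b n + (MAX k\<in>{1..n}. \<bar>?S' k\<bar>) / b n < 1"
        using lim0 by (rule order_tendstoD) simp
      ultimately have "\<forall>\<^sub>F n in sequentially. False"
        using eventually_ge_at_top[of 2]
      proof eventually_elim
        case (elim n)
        have "real n * ?\<mu> = ?S n - ?S' n"
          by (simp add: sum_subtractf)
        then have "\<bar>real n * ?\<mu>\<bar> \<le> \<bar>?S n\<bar> + \<bar>?S' n\<bar>"
          by linarith
        also have "\<dots> \<le> (MAX k\<in>{1..n}. \<bar>?S k\<bar>) + (MAX k\<in>{1..n}. \<bar>?S' k\<bar>)"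
          using elim by (intro add_mono Max_ge[of n n ?S] Max_ge[of n n ?S']) auto
        also have "\<dots> < b n"
          using elim pos[of n] by (simp add: field_simps)
        finally show ?case
          using elim pos[of n] by (simp add: abs_mult field_simps)
      qed
      then show False by simp
    qed
  qed
  then show "?\<mu> = 0" by simp
qed

end

section \<open>The norming sequence with a logarithmic factor\<close>

definition norm_seq :: "real \<Rightarrow> real \<Rightarrow> nat \<Rightarrow> real" where
  "norm_seq \<alpha> \<gamma> n = real n powr (1 / \<alpha>) * log 2 (real n) powr (1 / \<gamma>)"

text \<open>The lower bound needs only monotonicity of the logarithm. For the upper bound, a
  logarithm is dominated by any positive power, so the exponent can be kept at the midpoint of 1 /
  \<alpha> and 1.\<close>

lemma norming_norm_seq:
  fixes \<alpha> \<gamma> :: real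
  assumes \<alpha>: "1 < \<alpha>" "\<alpha> < 2" and \<gamma>: "0 < \<gamma>"
  obtains K where "norming (norm_seq \<alpha> \<gamma>) (1 / \<alpha>) ((1 + 1 / \<alpha>) / 2) K"
proof -
  \<comment> \<open>Chosen so that the power \<delta> spent on bounding the logarithm, after raising
    to 1 / \<gamma>, uses exactly half of the gap between 1 / \<alpha> and 1.\<close>
  define \<delta> where "\<delta> = \<gamma> * ((1 - 1 / \<alpha>) / 2)"
  define L where "L = 1 + 1 / (\<delta> * ln 2)"
  have \<delta>: "\<delta> > 0"
    using \<alpha> \<gamma> by (simp add: \<delta>_def)
  have L: "L \<ge> 1"
    using \<delta> by (simp add: L_def)
  have exps: "1 / \<alpha> + \<delta> * (1 / \<gamma>) = (1 + 1 / \<alpha>) / 2"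
    using \<alpha> \<gamma> by (simp add: \<delta>_def field_simps)
  show ?thesis
  proof (rule that[of "L powr (1 / \<gamma>)"], unfold_locales)
    show "0 < norm_seq \<alpha> \<gamma> 2"
      by (simp add: norm_seq_def)
    fix n m :: nat assume nm: "2 \<le> n" "n \<le> m"
    define r where "r = real m / real n"
    have r: "1 \<le> r" and m: "real m = r * real n"
      using nm by (auto simp: r_def)
    have log_n: "1 \<le> log 2 (real n)"
      using nm by simp
    have log_m: "log 2 (real m) = log 2 r + log 2 (real n)"
      using nm r unfolding m by (subst log_mult) auto
    have m_powr: "real m powr (1 / \<alpha>) = r powr (1 / \<alpha>) * real n powr (1 / \<alpha>)"
      using nm r unfolding m by (subst powr_mult) auto
    have "log 2 (real n) powr (1 / \<gamma>) \<le> log 2 (real m) powr (1 / \<gamma>)"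
      using nm \<gamma> log_n r unfolding log_m by (intro powr_mono2) auto
    then show "(real m / real n) powr (1 / \<alpha>) * norm_seq \<alpha> \<gamma> n \<le> norm_seq \<alpha> \<gamma> m"
      unfolding r_def[symmetric] norm_seq_def m_powr
      by (simp add: mult.assoc mult_left_mono)
    have "log 2 r \<le> r powr \<delta> / \<delta> / ln 2"
      unfolding log_def using ln_powr_bound[OF r \<delta>] by (intro divide_right_mono) auto
    moreover have one: "1 \<le> r powr \<delta>"
      using r \<delta> by (intro ge_one_powr_ge_zero) auto
    ultimately have log_r: "1 + log 2 r \<le> L * r powr \<delta>"
      by (simp add: L_def algebra_simps)
    \<comment> \<open>As \<open>log 2 n\<close> is at least 1, the sum of logarithms is at most a
      product, from which the value at n factors out.\<close>
    have "log 2 (real m) \<le> log 2 (real n) * (1 + log 2 r)"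
      using mult_right_mono[OF log_n, of "log 2 r"] r unfolding log_m by (simp add: algebra_simps)
    also have "\<dots> \<le> log 2 (real n) * (L * r powr \<delta>)"
      using log_n log_r by (intro mult_left_mono) auto
    finally have "log 2 (real m) powr (1 / \<gamma>) \<le> (log 2 (real n) * (L * r powr \<delta>)) powr (1 / \<gamma>)"
      using nm \<gamma> by (intro powr_mono2) auto
    also have "\<dots> = log 2 (real n) powr (1 / \<gamma>) * (L powr (1 / \<gamma>) * r powr (\<delta> * (1 / \<gamma>)))"
      using log_n L r by (simp add: powr_mult powr_powr)
    finally have "norm_seq \<alpha> \<gamma> m \<le> r powr (1 / \<alpha>) * real n powr (1 / \<alpha>) *
        (log 2 (real n) powr (1 / \<gamma>) * (L powr (1 / \<gamma>) * r powr (\<delta> * (1 / \<gamma>))))"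
      unfolding norm_seq_def m_powr by (intro mult_left_mono) auto
    also have "\<dots> = L powr (1 / \<gamma>) * (r powr (1 / \<alpha>) * r powr (\<delta> * (1 / \<gamma>))) * norm_seq \<alpha> \<gamma> n"
      by (simp add: norm_seq_def mult_ac)
    also have "r powr (1 / \<alpha>) * r powr (\<delta> * (1 / \<gamma>)) = r powr ((1 + 1 / \<alpha>) / 2)"
      unfolding powr_add[symmetric] exps ..
    finally show "norm_seq \<alpha> \<gamma> m \<le> L powr (1 / \<gamma>) * (real m / real n) powr ((1 + 1 / \<alpha>) / 2) * norm_seq \<alpha> \<gamma> n"
      unfolding r_def[symmetric] .
  qed (use \<alpha> in \<open>simp_all add: field_simps\<close>)
qed

lemma norm_seq_powr:
  assumes "\<alpha> > 0"
  shows "norm_seq \<alpha> \<gamma> n powr \<alpha> = real n * log 2 (real n) powr (\<alpha> / \<gamma>)"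
proof (cases "n = 0")
  case False
  then have "0 \<le> log 2 (real n)"
    by simp
  then show ?thesis
    using assms False by (simp add: norm_seq_def powr_mult powr_powr)
qed (use assms in \<open>simp add: norm_seq_def\<close>)

section \<open>Comparison of the moment with the generalized inverse\<close>

lemma log2_Suc_le: "2 \<le> m \<Longrightarrow> log 2 (real m + 1) \<le> 2 * log 2 (real m)"
proof -
  assume m: "2 \<le> m"
  have "m + 1 \<le> m * m"
    using mult_le_mono1[OF m, of m] m by linarith
  then have "real m + 1 \<le> real m * real m"
    unfolding of_nat_mult[symmetric] by linarith
  then have "log 2 (real m + 1) \<le> log 2 (real m * real m)"
    using m by (intro log_mono) auto
  also have "\<dots> = 2 * log 2 (real m)"
    using m by (simp add: log_mult)
  finally show ?thesis .
qed

locale log_norming = norming "norm_seq \<alpha> \<gamma>" p \<beta> K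
  for \<alpha> \<gamma> p \<beta> K :: real +
  assumes \<alpha>_pos: "0 < \<alpha>" and \<gamma>_pos: "0 < \<gamma>"
begin

definition moment :: "real \<Rightarrow> real" where
  "moment x = x powr \<alpha> / log 2 (x + 2) powr (\<alpha> / \<gamma>)"

lemma moment_measurable [measurable]: "moment \<in> borel_measurable borel"
  unfolding moment_def[abs_def] by measurable

lemma moment_nonneg: "0 \<le> moment x"
  by (simp add: moment_def)

text \<open>Locates x between consecutive values of the sequence. The starting index 2 is a separate
  case, since there x has no lower neighbour.\<close>

lemma idx_cases:
  obtains (eq_2) "idx x = 2" "x \<le> norm_seq \<alpha> \<gamma> 2"
  | (Suc) m where "2 \<le> m" "idx x = Suc m" "norm_seq \<alpha> \<gamma> m < x" "x \<le> norm_seq \<alpha> \<gamma> (Suc m)"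
proof (cases "idx x = 2")
  case True
  then show ?thesis
    using eq_2 le_b_idx[of x] by simp
next
  case False
  then obtain m where m: "idx x = Suc m" "2 \<le> m"
    using idx_ge_2[of x] by (cases "idx x") auto
  then show ?thesis
    using Suc[of m] le_b_idx[of x] less_idx_iff[of m x] by simp
qed

text \<open>For \<open>idx x = m + 1\<close>, the upper neighbour bounds
  \<open>x powr \<alpha>\<close> by \<open>(m + 1)\<close> times a power of
  \<open>log 2 (m + 1)\<close>. The lower neighbour gives m at most a power of x + 2, so that
  logarithm is at most \<open>2 * \<alpha> * log 2 (x + 2)\<close> and the logarithmic factors
  cancel. The first summand of the constant serves the case \<open>idx x = 2\<close>.\<close>

lemma moment_le_idx:
  assumes "0 \<le> x"
  shows "moment x \<le> (norm_seq \<alpha> \<gamma> 2 powr \<alpha> + (2 * \<alpha>) powr (\<alpha> / \<gamma>)) * real (idx x)"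
proof (cases x rule: idx_cases)
  case eq_2
  have "1 \<le> log 2 (x + 2)"
    using assms by simp
  then have "1 \<le> log 2 (x + 2) powr (\<alpha> / \<gamma>)"
    using \<alpha>_pos \<gamma>_pos by (intro ge_one_powr_ge_zero) auto
  then have "moment x \<le> x powr \<alpha> / 1"
    unfolding moment_def by (intro divide_left_mono) auto
  also have "\<dots> \<le> norm_seq \<alpha> \<gamma> 2 powr \<alpha>"
    using eq_2 assms \<alpha>_pos by (simp add: powr_mono2)
  also have "\<dots> \<le> (norm_seq \<alpha> \<gamma> 2 powr \<alpha> + (2 * \<alpha>) powr (\<alpha> / \<gamma>)) * real (idx x)"
    using eq_2 by simp
  finally show ?thesis .
next
  case (Suc m)
  have log_m: "1 \<le> log 2 (real m)"
    using Suc by simp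
  have "real m powr (1 / \<alpha>) * 1 \<le> norm_seq \<alpha> \<gamma> m"
    unfolding norm_seq_def using log_m \<gamma>_pos by (intro mult_left_mono ge_one_powr_ge_zero) auto
  then have le: "real m powr (1 / \<alpha>) \<le> x + 2"
    using Suc by simp
  have "log 2 (real (Suc m)) \<le> 2 * log 2 (real m)"
    using log2_Suc_le[OF Suc(1)] by (simp add: add.commute)
  also have "\<dots> = 2 * \<alpha> * log 2 (real m powr (1 / \<alpha>))"
    using \<alpha>_pos by (simp add: log_powr)
  also have "\<dots> \<le> 2 * \<alpha> * log 2 (x + 2)"
    using le \<alpha>_pos Suc by (intro mult_left_mono log_mono) auto
  finally have log_le: "log 2 (real (Suc m)) \<le> 2 * \<alpha> * log 2 (x + 2)" .
  have log_x: "0 < log 2 (x + 2)"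
    using assms by simp
  have "x powr \<alpha> \<le> norm_seq \<alpha> \<gamma> (Suc m) powr \<alpha>"
    using Suc assms \<alpha>_pos by (intro powr_mono2) auto
  also have "\<dots> = real (idx x) * log 2 (real (Suc m)) powr (\<alpha> / \<gamma>)"
    using \<alpha>_pos Suc by (simp add: norm_seq_powr)
  also have "\<dots> \<le> real (idx x) * (2 * \<alpha> * log 2 (x + 2)) powr (\<alpha> / \<gamma>)"
    using log_le \<alpha>_pos \<gamma>_pos by (intro mult_left_mono powr_mono2) auto
  also have "\<dots> = (2 * \<alpha>) powr (\<alpha> / \<gamma>) * real (idx x) * log 2 (x + 2) powr (\<alpha> / \<gamma>)"
    using log_x \<alpha>_pos by (simp add: powr_mult)
  finally have "moment x \<le> (2 * \<alpha>) powr (\<alpha> / \<gamma>) * real (idx x)"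
    using log_x unfolding moment_def by (simp add: pos_divide_le_eq)
  also have "\<dots> \<le> (norm_seq \<alpha> \<gamma> 2 powr \<alpha> + (2 * \<alpha>) powr (\<alpha> / \<gamma>)) * real (idx x)"
    by (intro mult_right_mono) auto
  finally show ?thesis .
qed

text \<open>Here the neighbours swap roles: the lower one bounds \<open>x powr \<alpha>\<close> from
  below, and linear growth of the sequence bounds \<open>log 2 (x + 2)\<close> by a multiple of
  \<open>log 2 m\<close>. The additive 2 covers small x.\<close>

lemma idx_le_moment:
  obtains L where "\<And>x. 0 \<le> x \<Longrightarrow> real (idx x) \<le> 2 + L * moment x"
proof -
  \<comment> \<open>The added 1 absorbs the 2 in x + 2, as m + 1 is at least 2.\<close>
  define G where "G = K * norm_seq \<alpha> \<gamma> 2 + 1"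
  define L where "L = log 2 G + 2"
  have G: "1 \<le> G"
    using K_ge_1 pos_2 by (simp add: G_def)
  have L: "1 \<le> L"
    using G by (simp add: L_def add_increasing)
  have "real (idx x) \<le> 2 + 2 * L powr (\<alpha> / \<gamma>) * moment x" if x: "0 \<le> x" for x
  proof (cases x rule: idx_cases)
    case eq_2
    then show ?thesis
      using moment_nonneg[of x] by simp
  next
    case (Suc m)
    have log_m: "1 \<le> log 2 (real m)"
      using Suc by simp
    have "x + 2 \<le> G * (real m + 1)"
      using le_idx[of x] Suc by (simp add: G_def algebra_simps)
    then have "log 2 (x + 2) \<le> log 2 (G * (real m + 1))"
      using x by (intro log_mono) auto
    also have "\<dots> = log 2 G + log 2 (real m + 1)"
      using G by (simp add: log_mult)
    also have "\<dots> \<le> log 2 G * log 2 (real m) + 2 * log 2 (real m)"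
      using log2_Suc_le[OF Suc(1)] mult_left_mono[OF log_m, of "log 2 G"] G by simp
    also have "\<dots> = L * log 2 (real m)"
      by (simp add: L_def algebra_simps)
    finally have log_x: "log 2 (x + 2) \<le> L * log 2 (real m)" .
    have "0 < log 2 (x + 2)"
      using x by simp
    then have pos_x: "0 < log 2 (x + 2) powr (\<alpha> / \<gamma>)"
      by simp
    have "real m * log 2 (x + 2) powr (\<alpha> / \<gamma>) \<le> real m * (L * log 2 (real m)) powr (\<alpha> / \<gamma>)"
      using log_x x \<alpha>_pos \<gamma>_pos by (intro mult_left_mono powr_mono2) auto
    also have "\<dots> = L powr (\<alpha> / \<gamma>) * norm_seq \<alpha> \<gamma> m powr \<alpha>"
      using L log_m \<alpha>_pos by (simp add: norm_seq_powr powr_mult)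
    also have "\<dots> \<le> L powr (\<alpha> / \<gamma>) * x powr \<alpha>"
      using Suc pos[of m] \<alpha>_pos by (intro mult_left_mono powr_mono2) auto
    finally have "real m \<le> L powr (\<alpha> / \<gamma>) * moment x"
      using pos_x by (simp add: moment_def pos_le_divide_eq)
    then show ?thesis
      using Suc by simp
  qed
  then show ?thesis by (rule that)
qed

end

text \<open>Each integrand is dominated by an affine function of the other, and constants are
  integrable on a probability space.\<close>

lemma (in prob_space) integrable_moment_iff:
  assumes "log_norming \<alpha> \<gamma> p \<beta> K" and [measurable]: "Y \<in> borel_measurable M"
  shows "integrable M (\<lambda>\<omega>. \<bar>Y \<omega>\<bar> powr \<alpha> / log 2 (\<bar>Y \<omega>\<bar> + 2) powr (\<alpha> / \<gamma>))
    \<longleftrightarrow> integrable M (\<lambda>\<omega>. real (norming.idx (norm_seq \<alpha> \<gamma>) \<bar>Y \<omega>\<bar>))"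
proof -
  interpret log_norming \<alpha> \<gamma> p \<beta> K by fact
  obtain L where L: "\<And>x. 0 \<le> x \<Longrightarrow> real (idx x) \<le> 2 + L * moment x"
    using idx_le_moment by blast
  have "integrable M (\<lambda>\<omega>. moment \<bar>Y \<omega>\<bar>) \<longleftrightarrow> integrable M (\<lambda>\<omega>. real (idx \<bar>Y \<omega>\<bar>))"
  proof
    assume "integrable M (\<lambda>\<omega>. moment \<bar>Y \<omega>\<bar>)"
    then have int: "integrable M (\<lambda>\<omega>. 2 + L * moment \<bar>Y \<omega>\<bar>)"
      by simp
    show "integrable M (\<lambda>\<omega>. real (idx \<bar>Y \<omega>\<bar>))"
    proof (rule Bochner_Integration.integrable_bound[OF int])
      show "AE \<omega> in M. norm (real (idx \<bar>Y \<omega>\<bar>)) \<le> norm (2 + L * moment \<bar>Y \<omega>\<bar>)"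
        unfolding real_norm_def by (intro AE_I2) (use L in \<open>simp add: order_trans[OF _ abs_ge_self]\<close>)
    qed measurable
  next
    let ?c = "norm_seq \<alpha> \<gamma> 2 powr \<alpha> + (2 * \<alpha>) powr (\<alpha> / \<gamma>)"
    assume "integrable M (\<lambda>\<omega>. real (idx \<bar>Y \<omega>\<bar>))"
    then have int: "integrable M (\<lambda>\<omega>. ?c * real (idx \<bar>Y \<omega>\<bar>))"
      by simp
    show "integrable M (\<lambda>\<omega>. moment \<bar>Y \<omega>\<bar>)"
    proof (rule Bochner_Integration.integrable_bound[OF int])
      show "AE \<omega> in M. norm (moment \<bar>Y \<omega>\<bar>) \<le> norm (?c * real (idx \<bar>Y \<omega>\<bar>))"
      proof (rule AE_I2)
        fix \<omega>
        show "norm (moment \<bar>Y \<omega>\<bar>) \<le> norm (?c * real (idx \<bar>Y \<omega>\<bar>))"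
          unfolding real_norm_def abs_of_nonneg[OF moment_nonneg]
          by (rule order_trans[OF moment_le_idx abs_ge_self]) simp
      qed
    qed measurable
  qed
  then show ?thesis
    by (simp add: moment_def)
qed

section \<open>Equivalence of the moment condition, the weighted series and the strong law\<close>

theorem corollary3p3:
  fixes M :: "'a measure"
    and X :: "nat \<Rightarrow> 'a \<Rightarrow> real"
    and X0 :: "'a \<Rightarrow> real"
    and \<alpha> \<gamma> :: real
  assumes "prob_space M"
    and "1 < \<alpha>" and "\<alpha> < 2" and "\<gamma> > 0"
    and "\<And>n. n \<ge> 1 \<Longrightarrow> X n \<in> borel_measurable M"
    and "prob_space.neg_assoc M {1..} X"
    and "X0 \<in> borel_measurable M"
    and "\<And>n. n \<ge> 1 \<Longrightarrow> distr M borel (X n) = distr M borel X0"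
  shows
    "((integrable M X0 \<and> (\<integral>\<omega>. X0 \<omega> \<partial>M) = 0 \<and>
       integrable M (\<lambda>\<omega>. \<bar>X0 \<omega>\<bar> powr \<alpha> / log 2 (\<bar>X0 \<omega>\<bar> + 2) powr (\<alpha> / \<gamma>)))
      \<longleftrightarrow>
      (\<forall>a :: nat \<Rightarrow> nat \<Rightarrow> real.
         (\<exists>C. \<forall>n\<ge>1. (\<Sum>i=1..n. (a n i)\<^sup>2) \<le> C * real n) \<longrightarrow>
         (\<forall>\<epsilon>>0. summable (\<lambda>n. (1 / real n) *
            measure M {\<omega> \<in> space M. (MAX k\<in>{1..n}. \<bar>\<Sum>i=1..k. a n i * X i \<omega>\<bar>)
                                       > \<epsilon> * real n powr (1 / \<alpha>) * log 2 (real n) powr (1 / \<gamma>)}))))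
     \<and>
     ((integrable M X0 \<and> (\<integral>\<omega>. X0 \<omega> \<partial>M) = 0 \<and>
       integrable M (\<lambda>\<omega>. \<bar>X0 \<omega>\<bar> powr \<alpha> / log 2 (\<bar>X0 \<omega>\<bar> + 2) powr (\<alpha> / \<gamma>)))
      \<longleftrightarrow>
      (AE \<omega> in M. (\<lambda>n. (MAX k\<in>{1..n}. \<bar>\<Sum>i=1..k. X i \<omega>\<bar>)
                        / (real n powr (1 / \<alpha>) * log 2 (real n) powr (1 / \<gamma>)))
                   \<longlonglongrightarrow> 0))"
    (is "(?i \<longleftrightarrow> ?ii) \<and> (?i \<longleftrightarrow> ?iii)")
proof -
  interpret prob_space M by fact
  obtain K where "norming (norm_seq \<alpha> \<gamma>) (1 / \<alpha>) ((1 + 1 / \<alpha>) / 2) K"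
    using norming_norm_seq assms(2-4) by blast
  then interpret norming "norm_seq \<alpha> \<gamma>" "1 / \<alpha>" "(1 + 1 / \<alpha>) / 2" K .
  interpret neg_assoc_identical M "norm_seq \<alpha> \<gamma>" "1 / \<alpha>" "(1 + 1 / \<alpha>) / 2" K X X0
    using assms by unfold_locales auto
  have "log_norming \<alpha> \<gamma> (1 / \<alpha>) ((1 + 1 / \<alpha>) / 2) K"
    using assms by unfold_locales auto
  note iff = integrable_moment_iff[OF this assms(7)]
  \<comment> \<open>For positive n, a finite maximum exceeds a level iff some member does. At n = 0
    the maximum is over the empty set, but the factor \<open>1 / real 0\<close> is 0 on both
    sides.\<close>
  have event: "1 / real n * prob {\<omega> \<in> space M. (MAX k\<in>{1..n}. \<bar>f k \<omega>\<bar>)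
          > \<epsilon> * real n powr (1 / \<alpha>) * log 2 (real n) powr (1 / \<gamma>)}
      = 1 / real n * prob {\<omega> \<in> space M. \<exists>k\<in>{1..n}. \<bar>f k \<omega>\<bar> > \<epsilon> * norm_seq \<alpha> \<gamma> n}"
    for f :: "nat \<Rightarrow> 'a \<Rightarrow> real" and n \<epsilon>
  proof (cases "n = 0")
    case False
    then have "t < (MAX k\<in>{1..n}. \<bar>f k \<omega>\<bar>) \<longleftrightarrow> (\<exists>k\<in>{1..n}. t < \<bar>f k \<omega>\<bar>)" for t \<omega>
      by (subst Max_gr_iff) auto
    then show ?thesis
      unfolding norm_seq_def mult.assoc by presburger
  qed simp
  \<comment> \<open>The implications form the cycle (i), (ii), (iii), (i). In this one the mean is
    0, so the centred sums are the sums themselves.\<close>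
  have "?ii" if i: "?i"
  proof (intro allI impI)
    fix a :: "nat \<Rightarrow> nat \<Rightarrow> real" and \<epsilon> :: real
    assume "\<exists>C. \<forall>n\<ge>1. (\<Sum>i=1..n. (a n i)\<^sup>2) \<le> C * real n" and \<epsilon>: "\<epsilon> > 0"
    then obtain C where C: "\<And>n. n \<ge> 1 \<Longrightarrow> (\<Sum>i=1..n. (a n i)\<^sup>2) \<le> C * real n"
      by blast
    have Q: "integrable M (\<lambda>\<omega>. real (idx \<bar>X0 \<omega>\<bar>))" and mean: "expectation X0 = 0"
      using i iff by auto
    show "summable (\<lambda>n. (1 / real n) * prob {\<omega> \<in> space M. (MAX k\<in>{1..n}. \<bar>\<Sum>i=1..k. a n i * X i \<omega>\<bar>)
        > \<epsilon> * real n powr (1 / \<alpha>) * log 2 (real n) powr (1 / \<gamma>)})"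
      unfolding event using summable_weighted_sums[OF Q \<epsilon> C] unfolding mean diff_zero .
  qed
  \<comment> \<open>Only the array with all weights 1 is used.\<close>
  moreover have "?iii" if ii: "?ii"
  proof -
    have "(\<lambda>\<omega>. \<Sum>i=1..k. X i \<omega>) \<in> borel_measurable M" for k
      using sums_measurable[where c = 0] by simp
    moreover have "summable (\<lambda>n. 1 / real n *
      prob {\<omega> \<in> space M. \<exists>k\<in>{1..n}. \<bar>\<Sum>i=1..k. X i \<omega>\<bar> > \<epsilon> * norm_seq \<alpha> \<gamma> n})" if "\<epsilon> > 0" for \<epsilon>
    proof -
      have "\<exists>C. \<forall>n\<ge>1. (\<Sum>i=1..n. (1::real)\<^sup>2) \<le> C * real n"
        by (intro exI[of _ 1]) simp
      then show ?thesis
        using ii[rule_format, of "\<lambda>_ _. 1"] that unfolding event mult_1_left by blast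
    qed
    ultimately show ?thesis
      using summable_maximal_imp_AE_tendsto[of "\<lambda>k \<omega>. \<Sum>i=1..k. X i \<omega>"]
      unfolding norm_seq_def by blast
  qed
  moreover have "?i" if iii: "?iii"
    using strong_law_converse[OF iii[folded norm_seq_def]] integrable_X0 iff by blast
  ultimately show ?thesis by blast
qed

end
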